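(* Let $G$ be a compact group with normalized Haar measure $m_G$, let $X$ be a complex Banach space, and let $\nu$ be a nonzero $X$-valued vector measure on $G$ which is absolutely continuous with respect to $m_G$ and norm integral translation invariant. If $\mu$ is a Rybakov control measure for $\nu$, then there exists $h\in L^1(\nu)^*$ with $h>0$ such that $\|h\|_{L^1(\nu)^*}=\|\nu\|^{-1}$ and $$m_G(A)=\int_A h\,d\mu\quad\text{for all } A\in\mathcal{B}(G),$$ where $L^1(\nu)^*$ is the Köthe dual of $L^1(\nu)$ (with respect to $\mu$).
   Context: $\mathcal{B}(G)$ is the Borel $\sigma$-algebra of $G$. A vector measure $\nu$ is a $\sigma$-additive map $\mathcal{B}(G)\to X$. $X'$ is the topological dual of $X$, $B_{X'}$ its closed unit ball; for $x'\in X'$, $\langle\nu,x'\rangle(A)=\langle\nu(A),x'\rangle$ is a complex measure with total variation $|\langle\nu,x'\rangle|$. $\nu$ is absolutely continuous w.r.t. a nonnegative measure $\mu$ ($\nu\ll\mu$) if $\nu(A)\to0$ as $\mu(A)\to 0$. The semivariation is $\|\nu\|(A)=\sup_{x'\in B_{X'}}|\langle\nu,x'\rangle|(A)$, and $\|\nu\|:=\|\nu\|(G)$. A finite positive measure $\mu$ is a Rybakov control measure for $\nu$ if $\nu\ll\mu=|\langle\nu,x'\rangle|$ for some $x'\in X'$; then $\mu$ and $\nu$ have the same null sets ($A$ is $\nu$-null if $\nu(B)=0$ for all Borel $B\subset A$). $\tau_s f(t)=f(s^{-1}t)$. For a simple function $\phi=\sum_i\alpha_i\chi_{A_i}$, $I_\nu(\phi)=\int_G\phi\,d\nu=\sum_i\alpha_i\nu(A_i)$.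 $\nu$ is norm integral translation invariant if $\|I_\nu(\tau_s\phi)\|=\|I_\nu(\phi)\|$ for every simple function $\phi$ on $G$ and every $s\in G$. $L^1_w(\nu)$ is the space of complex measurable $f$ (modulo equality off $\nu$-null sets) with $\|f\|_\nu=\sup_{x'\in B_{X'}}\int_G|f|\,d|\langle\nu,x'\rangle|<\infty$; $L^1(\nu)$ is the closure of the simple functions in it. The Köthe dual $L^1(\nu)^*$ of $L^1(\nu)$ with respect to $\mu$ is the space of measurable $g$ (modulo $\mu$-a.e. equality) with $fg\in L^1(\mu)$ for all $f\in L^1(\nu)$, normed by $\|g\|_{L^1(\nu)^*}=\sup\{\int_G|fg|\,d\mu:\|f\|_\nu\le1\}$. Here $h>0$ is understood $\mu$-almost everywhere. *)

theory Defs
  imports "HOL-Analysis.Analysis"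
begin

text \<open>
  Groups are written additively, following the class \<open>topological_group_add\<close>, which does not
  assume commutativity: \<open>s + t\<close> is the group product \<open>s t\<close> and \<open>- s\<close> is the inverse of \<open>s\<close>.
\<close>

class complex_banach = banach +
  fixes scaleC :: "complex \<Rightarrow> 'a \<Rightarrow> 'a"  (infixr "*\<^sub>C" 75)
  assumes scaleC_of_real: "complex_of_real r *\<^sub>C x = r *\<^sub>R x"
    and scaleC_add_right: "a *\<^sub>C (x + y) = a *\<^sub>C x + a *\<^sub>C y"
    and scaleC_add_left: "(a + b) *\<^sub>C x = a *\<^sub>C x + b *\<^sub>C x"
    and scaleC_scaleC: "a *\<^sub>C b *\<^sub>C x = (a * b) *\<^sub>C x"
    and norm_scaleC: "norm (a *\<^sub>C x) = cmod a * norm x"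

definition complex_dual :: "('x::complex_banach \<Rightarrow> complex) set" where
  "complex_dual = {x'. bounded_linear x' \<and> (\<forall>c x. x' (c *\<^sub>C x) = c * x' x)}"

definition dual_ball :: "('x::complex_banach \<Rightarrow> complex) set" where
  "dual_ball = {x' \<in> complex_dual. onorm x' \<le> 1}"

text \<open>
  A Haar measure is a regular Borel measure. Regularity has to be required explicitly, since
  the group need not be second countable.
\<close>

definition normalized_haar_measure :: "'g::topological_group_add measure \<Rightarrow> bool" where
  "normalized_haar_measure m \<longleftrightarrow>
     sets m = sets borel \<and> emeasure m UNIV = 1 \<and>
     (\<forall>A\<in>sets borel. emeasure m A = (INF U\<in>{U. open U \<and> A \<subseteq> U}. emeasure m U)) \<and>
     (\<forall>A\<in>sets borel. emeasure m A = (SUP K\<in>{K. compact K \<and> K \<subseteq> A}. emeasure m K)) \<and>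
     (\<forall>s. \<forall>A\<in>sets borel. emeasure m ((\<lambda>t. s + t) ` A) = emeasure m A)"

text \<open>
  Vector measures are represented by functions on all sets; only the values at Borel sets matter.
\<close>

definition vector_measure :: "('g::topological_space set \<Rightarrow> 'x::real_normed_vector) \<Rightarrow> bool" where
  "vector_measure \<nu> \<longleftrightarrow>
     (\<forall>A::nat \<Rightarrow> 'g set. range A \<subseteq> sets borel \<longrightarrow> disjoint_family A \<longrightarrow>
        (\<lambda>n. \<nu> (A n)) sums \<nu> (\<Union>n. A n))"

definition abs_cont_vm ::
    "('g::topological_space set \<Rightarrow> 'x::real_normed_vector) \<Rightarrow> 'g measure \<Rightarrow> bool" where
  "abs_cont_vm \<nu> \<mu> \<longleftrightarrow>
     (\<forall>\<epsilon>>0. \<exists>\<delta>>0. \<forall>A\<in>sets borel. emeasure \<mu> A < ennreal \<delta> \<longrightarrow> norm (\<nu> A) < \<epsilon>)"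

definition total_variation :: "('g::topological_space set \<Rightarrow> complex) \<Rightarrow> 'g set \<Rightarrow> ennreal" where
  "total_variation \<rho> A =
     (SUP P\<in>{P. finite P \<and> P \<subseteq> sets borel \<and> partition_on A P}. \<Sum>B\<in>P. ennreal (cmod (\<rho> B)))"

text \<open>
  For a complex measure \<open>\<rho>\<close>, the total variation is countably additive on the Borel sets, so
  that \<open>emeasure (variation_measure \<rho>)\<close> agrees there with \<open>total_variation \<rho>\<close>.
\<close>

definition variation_measure :: "('g::topological_space set \<Rightarrow> complex) \<Rightarrow> 'g measure" where
  "variation_measure \<rho> = measure_of UNIV (sets borel) (total_variation \<rho>)"

definition semivariation ::
    "('g::topological_space set \<Rightarrow> 'x::complex_banach) \<Rightarrow> 'g set \<Rightarrow> ennreal" where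
  "semivariation \<nu> A = (SUP x'\<in>dual_ball. total_variation (\<lambda>B. x' (\<nu> B)) A)"

definition rybakov_control_measure ::
    "('g::topological_space set \<Rightarrow> 'x::complex_banach) \<Rightarrow> 'g measure \<Rightarrow> bool" where
  "rybakov_control_measure \<nu> \<mu> \<longleftrightarrow>
     finite_measure \<mu> \<and> abs_cont_vm \<nu> \<mu> \<and>
     (\<exists>x'\<in>complex_dual. \<mu> = variation_measure (\<lambda>A. x' (\<nu> A)))"

definition translate :: "'g::group_add \<Rightarrow> ('g \<Rightarrow> 'b) \<Rightarrow> 'g \<Rightarrow> 'b" where
  "translate s f = (\<lambda>t. f (- s + t))"

text \<open>
  The integral of a simple function is taken over its canonical representation
  \<open>\<phi> = (\<Sum>y\<in>range \<phi>. y \<cdot> \<chi>(\<phi> -` {y}))\<close>; by additivity of \<open>\<nu>\<close> any other representation gives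
  the same value.
\<close>

definition vm_simple_integral ::
    "('g set \<Rightarrow> 'x::complex_banach) \<Rightarrow> ('g \<Rightarrow> complex) \<Rightarrow> 'x" where
  "vm_simple_integral \<nu> \<phi> = (\<Sum>y\<in>range \<phi>. y *\<^sub>C \<nu> (\<phi> -` {y}))"

definition norm_integral_translation_invariant ::
    "('g::topological_group_add set \<Rightarrow> 'x::complex_banach) \<Rightarrow> bool" where
  "norm_integral_translation_invariant \<nu> \<longleftrightarrow>
     (\<forall>\<phi> s. simple_function borel \<phi> \<longrightarrow>
        norm (vm_simple_integral \<nu> (translate s \<phi>)) = norm (vm_simple_integral \<nu> \<phi>))"

definition vm_norm ::
    "('g::topological_space set \<Rightarrow> 'x::complex_banach) \<Rightarrow> ('g \<Rightarrow> complex) \<Rightarrow> ennreal" where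
  "vm_norm \<nu> f =
     (SUP x'\<in>dual_ball. \<integral>\<^sup>+ t. ennreal (cmod (f t)) \<partial>variation_measure (\<lambda>A. x' (\<nu> A)))"

text \<open>
  The function spaces below consist of functions rather than classes of functions modulo null
  sets.
\<close>

definition L1_weak ::
    "('g::topological_space set \<Rightarrow> 'x::complex_banach) \<Rightarrow> ('g \<Rightarrow> complex) set" where
  "L1_weak \<nu> = {f \<in> borel_measurable borel. vm_norm \<nu> f < \<infinity>}"

definition L1_vm ::
    "('g::topological_space set \<Rightarrow> 'x::complex_banach) \<Rightarrow> ('g \<Rightarrow> complex) set" where
  "L1_vm \<nu> = {f \<in> L1_weak \<nu>. \<forall>\<epsilon>>0. \<exists>\<phi>. simple_function borel \<phi> \<and>
                  vm_norm \<nu> (\<lambda>t. f t - \<phi> t) < ennreal \<epsilon>}"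

definition kothe_dual ::
    "('g::topological_space set \<Rightarrow> 'x::complex_banach) \<Rightarrow> 'g measure \<Rightarrow> ('g \<Rightarrow> complex) set" where
  "kothe_dual \<nu> \<mu> =
     {g \<in> borel_measurable borel. \<forall>f\<in>L1_vm \<nu>. integrable \<mu> (\<lambda>t. f t * g t)}"

definition kothe_norm ::
    "('g::topological_space set \<Rightarrow> 'x::complex_banach) \<Rightarrow> 'g measure \<Rightarrow> ('g \<Rightarrow> complex) \<Rightarrow> ennreal"
    where
  "kothe_norm \<nu> \<mu> g =
     (SUP f\<in>{f \<in> L1_vm \<nu>. vm_norm \<nu> f \<le> 1}. \<integral>\<^sup>+ t. ennreal (cmod (f t * g t)) \<partial>\<mu>)"

end

theory Submission
  imports Defs
begin

text \<open>
  The heart of the matter is the inequality \<open>\<parallel>\<nu>\<parallel> \<integral>|f| dm \<le> \<parallel>f\<parallel>\<close>, where \<open>\<parallel>f\<parallel>\<close> on the right is the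
  \<open>\<nu>\<close>-norm of \<open>f\<close>; it becomes an equality for constant functions. Once it is known, the theorem is
  a change of measure: the inequality makes \<open>m\<close> absolutely continuous with respect to \<open>\<mu>\<close>, the
  Radon--Nikodym derivative \<open>h = dm/d\<mu>\<close> satisfies \<open>\<integral>|f h| d\<mu> = \<integral>|f| dm\<close>, and the inequality together with its
  equality case says that the norm of \<open>h\<close> in the dual is \<open>\<parallel>\<nu>\<parallel>\<^sup>-\<^sup>1\<close>. Positivity of \<open>h\<close> holds because \<open>\<mu>\<close> in
  turn vanishes on the \<open>m\<close>-null sets.

  The inequality rests on two facts. The first (\<open>nn_integral_translate_le\<close>) is that the \<open>\<nu>\<close>-norm does not
  see translations: for every \<open>x'\<close> in the dual ball and every \<open>s\<close>, the integral of \<open>|\<tau>\<^sub>s f|\<close> against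
  \<open>|\<langle>\<nu>, x'\<rangle>|\<close> is at most the \<open>\<nu>\<close>-norm of \<open>f\<close>. For a simple \<open>f\<close>, such an integral is approximated by
  \<open>x'(I\<^sub>\<nu>(\<psi>))\<close> with \<open>\<psi>\<close> simple and \<open>|\<psi>| \<le> |\<tau>\<^sub>s f|\<close>; by assumption \<open>I\<^sub>\<nu>(\<psi>)\<close> has the same norm as the integral of the
  back-translate of \<open>\<psi>\<close>, and a norming functional (\<open>exists_norming_functional\<close>) bounds that by the
  \<open>\<nu>\<close>-norm of \<open>f\<close>.

  The second fact (\<open>translation_average\<close>) is that averaging the integrals of \<open>\<tau>\<^sub>s u\<close> against a finite
  measure \<open>\<rho>\<close> that vanishes on \<open>m\<close>-null sets, over all \<open>s\<close> with respect to \<open>m\<close>, gives \<open>(\<integral>u dm) \<rho>(G)\<close>. This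
  is Tonelli's theorem together with the invariance of \<open>m\<close>. The group need not be second countable, so
  \<open>(s, t) \<mapsto> u(- s + t)\<close> may fail to be measurable for the product of the Borel algebras; regularity of
  \<open>m\<close> and Urysohn's lemma show that \<open>u\<close> can be changed on an \<open>m\<close>-null set so that it becomes measurable.

  Applying the second fact to \<open>\<rho> = |\<langle>\<nu>, x'\<rangle>|\<close> and \<open>u = |f|\<close>, estimating by the first, and taking the supremum
  over \<open>x'\<close> gives the inequality (\<open>semivariation_mult_haar_integral_le\<close>). The semivariation \<open>\<parallel>\<nu>\<parallel>\<close> is finite
  because the range of a vector measure is bounded (\<open>vector_measure_bounded\<close>).
\<close>

section \<open>Norming functionals on complex Banach spaces\<close>

definition sublinear :: "('a::real_vector \<Rightarrow> real) \<Rightarrow> bool" where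
  "sublinear q \<longleftrightarrow> (\<forall>x y. q (x + y) \<le> q x + q y) \<and> (\<forall>t>0. \<forall>x. q (t *\<^sub>R x) \<le> t * q x)"

lemma sublinear_add: "sublinear q \<Longrightarrow> q (x + y) \<le> q x + q y"
  by (simp add: sublinear_def)

lemma sublinear_scale_le: "sublinear q \<Longrightarrow> t > 0 \<Longrightarrow> q (t *\<^sub>R x) \<le> t * q x"
  by (simp add: sublinear_def)

lemma sublinear_zero:
  assumes "sublinear q" shows "q 0 = 0"
  using sublinear_scale_le[OF assms, of 2 0] sublinear_scale_le[OF assms, of "1/2" 0] by simp

lemma sublinear_scale:
  assumes q: "sublinear q" and t: "t \<ge> 0" shows "q (t *\<^sub>R x) = t * q x"
proof (cases "t = 0")
  case False
  then have t: "t > 0" using t by simp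
  have "q x \<le> inverse t * q (t *\<^sub>R x)"
    using sublinear_scale_le[OF q, of "inverse t" "t *\<^sub>R x"] t by simp
  then have "t * q x \<le> q (t *\<^sub>R x)" using t by (simp add: field_simps)
  then show ?thesis using sublinear_scale_le[OF q t, of x] by simp
qed (simp add: sublinear_zero[OF q])

lemma sublinear_neg: "sublinear q \<Longrightarrow> - q (- x) \<le> q x"
  using sublinear_add[of q x "- x"] sublinear_zero[of q] by simp

lemma sublinear_norm: "sublinear (norm :: 'a::real_normed_vector \<Rightarrow> real)"
  by (simp add: sublinear_def norm_triangle_ineq)

text \<open>
  Sliding \<open>q\<close> along the ray through \<open>y\<close> gives a sublinear functional below \<open>q\<close> that satisfies
  \<open>tilt q y (- y) \<le> - q y\<close>. The construction serves twice: it shows that a minimal sublinear functional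
  is additive, and, applied to the norm, it forces a dominated linear functional to attain the norm
  at \<open>y\<close>.
\<close>

definition tilt :: "('a::real_vector \<Rightarrow> real) \<Rightarrow> 'a \<Rightarrow> 'a \<Rightarrow> real" where
  "tilt q y x = (INF t\<in>{0..}. q (x + t *\<^sub>R y) - t * q y)"

lemma tilt_le:
  assumes q: "sublinear q" and t: "t \<ge> 0"
  shows "tilt q y x \<le> q (x + t *\<^sub>R y) - t * q y"
  unfolding tilt_def
proof (rule cINF_lower)
  have "- q (- x) \<le> q (x + s *\<^sub>R y) - s * q y" if "s \<ge> 0" for s
    using sublinear_add[OF q, of "x + s *\<^sub>R y" "- x"] sublinear_scale[OF q that, of y] by simp
  then show "bdd_below ((\<lambda>s. q (x + s *\<^sub>R y) - s * q y) ` {0..})"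
    by (auto intro!: bdd_belowI[of _ "- q (- x)"])
qed (use t in simp)

lemma tilt_greatest:
  "(\<And>t. t \<ge> 0 \<Longrightarrow> c \<le> q (x + t *\<^sub>R y) - t * q y) \<Longrightarrow> c \<le> tilt q y x"
  unfolding tilt_def by (rule cINF_greatest) auto

lemma sublinear_tilt:
  assumes q: "sublinear q" shows "sublinear (tilt q y)"
  unfolding sublinear_def
proof (intro conjI allI impI)
  fix a b
  have *: "tilt q y (a + b) \<le> (q (a + t *\<^sub>R y) - t * q y) + (q (b + u *\<^sub>R y) - u * q y)"
    if "t \<ge> 0" "u \<ge> 0" for t u
    using tilt_le[OF q, of "t + u" y "a + b"] sublinear_add[OF q, of "a + t *\<^sub>R y" "b + u *\<^sub>R y"] that
    by (simp add: algebra_simps)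
  have "tilt q y (a + b) - (q (a + t *\<^sub>R y) - t * q y) \<le> tilt q y b" if "t \<ge> 0" for t
    by (rule tilt_greatest) (use *[OF that] in \<open>simp add: algebra_simps\<close>)
  then have "tilt q y (a + b) - tilt q y b \<le> tilt q y a"
    by (intro tilt_greatest) (simp add: algebra_simps)
  then show "tilt q y (a + b) \<le> tilt q y a + tilt q y b" by simp
next
  fix r :: real and a assume r: "r > 0"
  have "tilt q y (r *\<^sub>R a) / r \<le> q (a + t *\<^sub>R y) - t * q y" if t: "t \<ge> 0" for t
  proof -
    have "tilt q y (r *\<^sub>R a) \<le> q (r *\<^sub>R (a + t *\<^sub>R y)) - r * t * q y"
      using tilt_le[OF q, of "r * t" y "r *\<^sub>R a"] r t by (simp add: scaleR_add_right)
    also have "\<dots> = r * (q (a + t *\<^sub>R y) - t * q y)"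
      using sublinear_scale[OF q, of r "a + t *\<^sub>R y"] r by (simp add: algebra_simps)
    finally show ?thesis using r by (simp add: field_simps)
  qed
  then have "tilt q y (r *\<^sub>R a) / r \<le> tilt q y a" by (rule tilt_greatest)
  then show "tilt q y (r *\<^sub>R a) \<le> r * tilt q y a" using r by (simp add: field_simps)
qed

text \<open>
  Zorn's lemma for the pointwise order. Because sublinear functionals are defined everywhere, no
  extension of partially defined functionals is involved. The infimum of a chain is finite because
  \<open>q x \<ge> - q (- x) \<ge> - p (- x)\<close>, and it is subadditive because two members of the chain are
  comparable.
\<close>

lemma exists_minimal_sublinear:
  assumes p: "sublinear (p :: 'a::real_vector \<Rightarrow> real)"
  shows "\<exists>q. sublinear q \<and> q \<le> p \<and> (\<forall>r. sublinear r \<longrightarrow> r \<le> q \<longrightarrow> r = q)"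
proof -
  define S where "S = {q. sublinear q \<and> q \<le> p}"
  have "\<exists>q\<in>S. \<forall>r\<in>S. r \<le> q \<longrightarrow> r = q"
  proof (rule predicate_Zorn[where P="\<lambda>a b. b \<le> a"])
    show "partial_order_on S (relation_of (\<lambda>a b. b \<le> a) S)"
      by (auto simp: partial_order_on_def preorder_on_def refl_on_def trans_def antisym_def
          relation_of_def)
  next
    fix C assume C: "C \<in> Chains (relation_of (\<lambda>a b. b \<le> a) S)"
    then have CS: "C \<subseteq> S" and tot: "\<And>a b. a \<in> C \<Longrightarrow> b \<in> C \<Longrightarrow> a \<le> b \<or> b \<le> a"
      by (auto simp: Chains_def relation_of_def)
    show "\<exists>u\<in>S. \<forall>a\<in>C. u \<le> a"
    proof (cases "C = {}")
      case True then show ?thesis using p by (auto simp: S_def)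
    next
      case False
      define u where "u = (\<lambda>x. INF q\<in>C. q x)"
      have subl: "sublinear q" and le: "q x \<le> p x" if "q \<in> C" for q x
        using CS that by (auto simp: S_def le_fun_def)
      have bdd: "bdd_below ((\<lambda>q. q x) ` C)" for x
      proof (rule bdd_belowI2)
        fix q assume "q \<in> C"
        from sublinear_neg[OF subl[OF this], of x] le[OF this, of "- x"]
        show "- p (- x) \<le> q x" by simp
      qed
      have lower: "u x \<le> q x" if "q \<in> C" for q x
        unfolding u_def using bdd that by (rule cINF_lower)
      have greatest: "c \<le> u x" if "\<And>q. q \<in> C \<Longrightarrow> c \<le> q x" for c x
        unfolding u_def using False that by (rule cINF_greatest)
      have "sublinear u"
        unfolding sublinear_def
      proof (intro conjI allI impI)
        fix x y
        have *: "u (x + y) \<le> q x + r y" if qr: "q \<in> C" "r \<in> C" for q r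
        proof -
          obtain s where s: "s \<in> C" "s \<le> q" "s \<le> r"
          proof (cases "q \<le> r")
            case True then show ?thesis using that qr by auto
          next
            case False then show ?thesis using tot[of q r] that qr by auto
          qed
          have "s x \<le> q x" "s y \<le> r y" using s by (simp_all add: le_fun_def)
          then show ?thesis
            using lower[OF s(1), of "x + y"] sublinear_add[OF subl[OF s(1)], of x y]
            by linarith
        qed
        have "u (x + y) - q x \<le> u y" if "q \<in> C" for q
          by (rule greatest) (use *[OF that] in \<open>simp add: algebra_simps\<close>)
        then have "u (x + y) - u y \<le> u x"
          by (intro greatest) (simp add: algebra_simps)
        then show "u (x + y) \<le> u x + u y" by simp
      next
        fix t :: real and x assume t: "t > 0"
        have "u (t *\<^sub>R x) / t \<le> q x" if "q \<in> C" for q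
          using lower[OF that, of "t *\<^sub>R x"] sublinear_scale_le[OF subl[OF that] t, of x] t
          by (simp add: field_simps)
        then have "u (t *\<^sub>R x) / t \<le> u x" by (rule greatest)
        then show "u (t *\<^sub>R x) \<le> t * u x" using t by (simp add: field_simps)
      qed
      moreover have "u \<le> p"
      proof (rule le_funI)
        fix x
        obtain q where "q \<in> C" using False by blast
        then show "u x \<le> p x" using lower[of q x] le[of q x] by simp
      qed
      ultimately show ?thesis using lower by (auto simp: S_def le_fun_def)
    qed
  qed
  then show ?thesis unfolding S_def by (auto intro: order_trans)
qed

text \<open>
  The Hahn--Banach theorem. A minimal sublinear \<open>q\<close> equals each of its tilts; reading \<open>q = tilt q y\<close>
  at the parameter \<open>1\<close> gives \<open>q x + q y \<le> q (x + y)\<close>, the inequality that sublinearity lacks.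
\<close>

theorem sublinear_dominates_linear:
  assumes p: "sublinear (p :: 'a::real_vector \<Rightarrow> real)"
  shows "\<exists>f. linear f \<and> (\<forall>x. f x \<le> p x)"
proof -
  obtain q where q: "sublinear q" and qp: "q \<le> p"
    and min: "\<And>r. sublinear r \<Longrightarrow> r \<le> q \<Longrightarrow> r = q"
    using exists_minimal_sublinear[OF p] by blast
  have add: "q (x + y) = q x + q y" for x y
  proof -
    have "tilt q y \<le> q"
      using tilt_le[OF q, of 0 y] by (simp add: le_fun_def)
    then have "tilt q y = q" using sublinear_tilt[OF q] by (intro min)
    then have "q x \<le> q (x + y) - q y" using tilt_le[OF q, of 1 y x] by simp
    then show ?thesis using sublinear_add[OF q, of x y] by simp
  qed
  have neg: "q (- x) = - q x" for x
    using add[of x "- x"] sublinear_zero[OF q] by simp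
  have "q (t *\<^sub>R x) = t * q x" for t x
    using sublinear_scale[OF q, of t x] sublinear_scale[OF q, of "- t" x] neg[of "t *\<^sub>R x"]
    by (cases "t \<ge> 0") auto
  then have "linear q" by (intro linearI) (auto simp: add)
  then show ?thesis using qp by (auto simp: le_fun_def)
qed

text \<open>
  Dominating by \<open>tilt norm x0\<close> instead of the norm itself makes the real functional \<open>f\<close> norming at
  \<open>x0\<close>. Its complexification \<open>f x - \<i> f (\<i> x)\<close> keeps the norm bound, since any of its values
  can be rotated onto the positive real axis, where it is a value of \<open>f\<close>.
\<close>

theorem exists_norming_functional:
  fixes x0 :: "'x::complex_banach"
  shows "\<exists>x'\<in>dual_ball. norm x0 \<le> cmod (x' x0)"
proof -
  obtain f where lin: "linear f" and f: "\<And>x. f x \<le> tilt norm x0 x"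
    using sublinear_dominates_linear[OF sublinear_tilt[OF sublinear_norm]] by blast
  have fle: "f x \<le> norm x" for x
    using f[of x] tilt_le[OF sublinear_norm, of 0 x0 x] by simp
  have "f (- x0) \<le> - norm x0"
    using f[of "- x0"] tilt_le[OF sublinear_norm, of 1 x0 "- x0"] by simp
  then have fx0: "norm x0 \<le> f x0" using lin by (simp add: linear_neg)
  define x' where "x' = (\<lambda>x. Complex (f x) (- f (\<i> *\<^sub>C x)))"
  have fC: "f (c *\<^sub>C x) = Re c * f x + Im c * f (\<i> *\<^sub>C x)" for c x
  proof -
    have "c *\<^sub>C x = (complex_of_real (Re c) + complex_of_real (Im c) * \<i>) *\<^sub>C x"
      by (rule arg_cong[where f="\<lambda>c. c *\<^sub>C x"]) (auto simp: complex_eq_iff)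
    also have "\<dots> = Re c *\<^sub>R x + Im c *\<^sub>R (\<i> *\<^sub>C x)"
      by (simp only: scaleC_add_left scaleC_scaleC[symmetric] scaleC_of_real)
    finally show ?thesis using lin by (simp add: linear_add linear_scale)
  qed
  have scale: "x' (c *\<^sub>C x) = c * x' x" for c x
    using fC[of c x] fC[of "\<i> * c" x]
    by (simp add: x'_def complex_eq_iff scaleC_scaleC)
  have add: "x' (x + y) = x' x + x' y" for x y
    using lin by (simp add: x'_def complex_eq_iff scaleC_add_right linear_add)
  have bound: "cmod (x' x) \<le> norm x" for x
  proof (cases "x' x = 0")
    case False
    define c where "c = cnj (x' x) / cmod (x' x)"
    have c: "cmod c = 1" using False by (simp add: c_def norm_divide)
    have "x' (c *\<^sub>C x) = cmod (x' x)"
      using False complex_norm_square[of "x' x"]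
      by (simp add: scale c_def field_simps power2_eq_square)
    then have "f (c *\<^sub>C x) = cmod (x' x)" by (simp add: x'_def complex_eq_iff)
    then show ?thesis using fle[of "c *\<^sub>C x"] by (simp add: norm_scaleC c)
  qed simp
  have "x' (r *\<^sub>R x) = r *\<^sub>R x' x" for r x
    using scale[of "complex_of_real r" x] by (simp add: scaleC_of_real scaleR_conv_of_real)
  then have "bounded_linear x'"
    by (intro bounded_linear_intro[where K=1]) (auto simp: add bound)
  moreover have "onorm x' \<le> 1"
    by (rule onorm_bound) (use bound in simp_all)
  ultimately have "x' \<in> dual_ball"
    by (simp add: dual_ball_def complex_dual_def scale)
  moreover have "norm x0 \<le> cmod (x' x0)"
    using fx0 abs_Re_le_cmod[of "x' x0"] by (simp add: x'_def)
  ultimately show ?thesis by blast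
qed

section \<open>Vector measures\<close>

lemma vector_measure_sums:
  "vector_measure \<nu> \<Longrightarrow> (\<And>n. A n \<in> sets borel) \<Longrightarrow> disjoint_family A \<Longrightarrow>
    (\<lambda>n. \<nu> (A n)) sums \<nu> (\<Union>n::nat. A n)"
  by (auto simp: vector_measure_def)

lemma vector_measure_empty:
  assumes "vector_measure \<nu>" shows "\<nu> {} = 0"
proof -
  have "(\<lambda>n::nat. \<nu> {}) sums \<nu> (\<Union>n::nat. {})"
    by (rule vector_measure_sums[OF assms]) (auto simp: disjoint_family_on_def)
  then have "summable (\<lambda>n::nat. \<nu> {})" by (rule sums_summable)
  then show ?thesis by (simp add: summable_const_iff)
qed

lemma vector_measure_Un:
  assumes \<nu>: "vector_measure \<nu>" and "A \<in> sets borel" "B \<in> sets borel" "A \<inter> B = {}"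
  shows "\<nu> (A \<union> B) = \<nu> A + \<nu> B"
proof -
  have "(\<lambda>n. \<nu> (binaryset A B n)) sums \<nu> (\<Union>n. binaryset A B n)"
    by (rule vector_measure_sums[OF \<nu>])
      (use assms in \<open>auto simp: binaryset_def disjoint_family_on_def\<close>)
  moreover have "(\<lambda>n. \<nu> (binaryset A B n)) sums (\<nu> A + \<nu> B)"
    by (rule binaryset_sums) (rule vector_measure_empty[OF \<nu>])
  ultimately show ?thesis by (auto simp: UN_binaryset_eq dest: sums_unique2)
qed

lemma vector_measure_Diff:
  assumes "vector_measure \<nu>" "A \<in> sets borel" "B \<in> sets borel" "B \<subseteq> A"
  shows "\<nu> (A - B) = \<nu> A - \<nu> B"
  using vector_measure_Un[of \<nu> B "A - B"] assms by (simp add: Un_absorb1)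

lemma vector_measure_Union:
  assumes \<nu>: "vector_measure \<nu>" and "finite P" "P \<subseteq> sets borel" "disjoint P"
  shows "\<nu> (\<Union>P) = (\<Sum>B\<in>P. \<nu> B)"
  using assms(2-)
proof (induction P rule: finite_induct)
  case empty
  show ?case by (simp add: vector_measure_empty[OF \<nu>])
next
  case (insert B P)
  have "disjoint P" using insert.prems(2) by (simp add: pairwise_insert)
  then have IH: "\<nu> (\<Union>P) = (\<Sum>B\<in>P. \<nu> B)" using insert by simp
  have "B \<inter> \<Union>P = {}"
    using insert.prems(2) insert.hyps(2) by (auto simp: pairwise_insert disjnt_iff)
  moreover have "\<Union>P \<in> sets borel"
    using insert by (intro sets.finite_Union) auto
  ultimately show ?case
    using vector_measure_Un[OF \<nu>, of B "\<Union>P"] insert IH by simp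
qed

lemma vector_measure_compose:
  "bounded_linear f \<Longrightarrow> vector_measure \<nu> \<Longrightarrow> vector_measure (\<lambda>A. f (\<nu> A))"
  by (auto simp: vector_measure_def intro: bounded_linear.sums)

text \<open>
  If a set \<open>A\<close> contains pieces of arbitrarily large measure, one of them has so large a measure that
  both it and its complement in \<open>A\<close> have measure of norm at least \<open>1\<close>, and one of the two again
  contains pieces of arbitrarily large measure. Iterating and collecting the other parts gives a
  disjoint sequence whose measures do not tend to \<open>0\<close>, against countable additivity.
\<close>

theorem vector_measure_bounded:
  assumes \<nu>: "vector_measure \<nu>"
  shows "\<exists>C. \<forall>A\<in>sets borel. norm (\<nu> A) \<le> C"
proof (rule ccontr)
  assume unbdd: "\<not> ?thesis"
  define bad where
    "bad A \<longleftrightarrow> A \<in> sets borel \<and> (\<forall>C. \<exists>B\<in>sets borel. B \<subseteq> A \<and> norm (\<nu> B) > C)" for A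
  have "bad UNIV"
    using unbdd by (auto simp: bad_def not_le)
  moreover have "\<exists>A'. bad A' \<and> A' \<subseteq> A \<and> 1 \<le> norm (\<nu> (A - A'))" if A: "bad A" for A
  proof -
    from A obtain B where B: "B \<in> sets borel" "B \<subseteq> A" "norm (\<nu> B) > norm (\<nu> A) + 1"
      unfolding bad_def by blast
    have Ab: "A \<in> sets borel" using A by (simp add: bad_def)
    have "norm (\<nu> B) - norm (\<nu> A) \<le> norm (\<nu> A - \<nu> B)"
      using norm_triangle_ineq2[of "\<nu> B" "\<nu> A"] by (simp add: norm_minus_commute)
    then have ge: "1 \<le> norm (\<nu> (A - B))" "1 \<le> norm (\<nu> B)"
      unfolding vector_measure_Diff[OF \<nu> Ab B(1,2)]
      using B(3) norm_ge_zero[of "\<nu> A"] by linarith+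
    have "bad B \<or> bad (A - B)"
    proof (rule ccontr)
      assume "\<not> (bad B \<or> bad (A - B))"
      then have not_bad: "\<not> bad B" "\<not> bad (A - B)" by auto
      from not_bad(1) B(1) obtain C1 where
        C1: "\<And>D. D \<in> sets borel \<Longrightarrow> D \<subseteq> B \<Longrightarrow> norm (\<nu> D) \<le> C1"
        unfolding bad_def by (meson not_less)
      from not_bad(2) B(1) Ab obtain C2 where
        C2: "\<And>D. D \<in> sets borel \<Longrightarrow> D \<subseteq> A - B \<Longrightarrow> norm (\<nu> D) \<le> C2"
        unfolding bad_def by (meson not_less sets.Diff)
      have "norm (\<nu> D) \<le> C1 + C2" if D: "D \<in> sets borel" "D \<subseteq> A" for D
      proof -
        have "\<nu> D = \<nu> (D \<inter> B) + \<nu> (D - B)"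
          using vector_measure_Un[OF \<nu>, of "D \<inter> B" "D - B"] D B(1)
          by (simp add: Int_Diff_Un Int_Diff_disjoint)
        moreover have "norm (\<nu> (D \<inter> B)) \<le> C1" "norm (\<nu> (D - B)) \<le> C2"
          using D B by (auto intro!: C1 C2)
        ultimately show ?thesis by (metis add_mono norm_triangle_ineq order_trans)
      qed
      then show False using A unfolding bad_def by (meson not_less)
    qed
    then show ?thesis
    proof
      assume "bad B"
      then show ?thesis using B ge by blast
    next
      assume "bad (A - B)"
      moreover have "A - (A - B) = B" using B(2) by blast
      ultimately show ?thesis using ge by (intro exI[of _ "A - B"]) auto
    qed
  qed
  ultimately obtain T :: "nat \<Rightarrow> _ set" where
    T: "\<And>n. bad (T n)" "\<And>n. T (Suc n) \<subseteq> T n" "\<And>n. 1 \<le> norm (\<nu> (T n - T (Suc n)))"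
    using dependent_nat_choice[of "\<lambda>_ A. bad A" "\<lambda>_ A A'. A' \<subseteq> A \<and> 1 \<le> norm (\<nu> (A - A'))"]
    by metis
  have dec: "T n \<subseteq> T m" if "m \<le> n" for m n
    by (rule lift_Suc_antimono_le[of T]) (use T(2) that in auto)
  have "disjoint_family (\<lambda>n. T n - T (Suc n))"
    unfolding disjoint_family_on_def
  proof (intro ballI impI)
    fix m n :: nat assume "m \<noteq> n"
    then have "Suc m \<le> n \<or> Suc n \<le> m" by auto
    then show "(T m - T (Suc m)) \<inter> (T n - T (Suc n)) = {}"
      using dec[of "Suc m" n] dec[of "Suc n" m] by blast
  qed
  moreover have "T n - T (Suc n) \<in> sets borel" for n
    using T(1)[of n] T(1)[of "Suc n"] by (auto simp: bad_def)
  ultimately have "(\<lambda>n. \<nu> (T n - T (Suc n))) sums \<nu> (\<Union>n. T n - T (Suc n))"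
    by (intro vector_measure_sums[OF \<nu>]) auto
  then have "(\<lambda>n. \<nu> (T n - T (Suc n))) \<longlonglongrightarrow> 0"
    by (intro summable_LIMSEQ_zero sums_summable)
  then have "(\<lambda>n. norm (\<nu> (T n - T (Suc n)))) \<longlonglongrightarrow> 0"
    by (rule tendsto_norm_zero)
  then have "(1::real) \<le> 0"
    by (rule LIMSEQ_le_const) (use T(3) in auto)
  then show False by simp
qed

section \<open>The variation of a complex measure\<close>

text \<open>
  Any finite disjoint family of Borel subsets may be used in place of a partition: removing the
  empty set and adding the uncovered rest of \<open>A\<close> does not decrease the sum.
\<close>

lemma total_variation_upper:
  assumes \<rho>: "vector_measure \<rho>" and A: "A \<in> sets borel"
    and P: "finite P" "P \<subseteq> sets borel" "disjoint P" "\<Union>P \<subseteq> A"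
  shows "(\<Sum>B\<in>P. ennreal (cmod (\<rho> B))) \<le> total_variation \<rho> A"
proof -
  define P' where "P' = insert (A - \<Union>P) P - {{}}"
  have "\<Union>P \<in> sets borel" using P by (intro sets.finite_Union) auto
  moreover have "disjoint (insert (A - \<Union>P) P)"
    using P(3) by (auto simp: pairwise_insert disjnt_iff)
  then have "disjoint P'"
    unfolding P'_def by (rule pairwise_subset) auto
  moreover have "\<Union>P' = A"
    using P(4) unfolding P'_def by blast
  ultimately have P': "finite P'" "P' \<subseteq> sets borel" "partition_on A P'"
    using P(1,2) A by (auto simp: P'_def partition_on_def subset_iff)
  have "(\<Sum>B\<in>P. ennreal (cmod (\<rho> B))) = (\<Sum>B\<in>P - {{}}. ennreal (cmod (\<rho> B)))"
  proof (rule sum.mono_neutral_right)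
    show "\<forall>B\<in>P - (P - {{}}). ennreal (cmod (\<rho> B)) = 0"
      using vector_measure_empty[OF \<rho>] by auto
  qed (use P(1) in auto)
  also have "\<dots> \<le> (\<Sum>B\<in>P'. ennreal (cmod (\<rho> B)))"
    using P'(1) by (intro sum_mono2) (auto simp: P'_def)
  also have "\<dots> \<le> total_variation \<rho> A"
    unfolding total_variation_def using P' by (intro SUP_upper) auto
  finally show ?thesis .
qed

lemma cmod_le_total_variation:
  "vector_measure \<rho> \<Longrightarrow> A \<in> sets borel \<Longrightarrow> ennreal (cmod (\<rho> A)) \<le> total_variation \<rho> A"
  using total_variation_upper[of \<rho> A "{A}"] by simp

lemma total_variation_mono:
  assumes \<rho>: "vector_measure \<rho>" and "A \<subseteq> B" "B \<in> sets borel"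
  shows "total_variation \<rho> A \<le> total_variation \<rho> B"
  unfolding total_variation_def[of \<rho> A]
  by (rule SUP_least, rule total_variation_upper[OF \<rho>]) (use assms in \<open>auto simp: partition_on_def\<close>)

lemma total_variation_eq_0:
  assumes "\<And>B. B \<in> sets borel \<Longrightarrow> B \<subseteq> A \<Longrightarrow> \<rho> B = 0"
  shows "total_variation \<rho> A = 0"
proof -
  have "(\<Sum>B\<in>P. ennreal (cmod (\<rho> B))) = 0"
    if "P \<subseteq> sets borel" "partition_on A P" for P
    using that by (intro sum.neutral) (auto simp: partition_on_def intro!: assms)
  then have "total_variation \<rho> A \<le> 0"
    unfolding total_variation_def by (intro SUP_least) auto
  then show ?thesis by simp
qed

lemma total_variation_superadditive:
  assumes \<rho>: "vector_measure \<rho>" and A: "A \<in> sets borel" and B: "B \<in> sets borel"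
    and AB: "A \<inter> B = {}"
  shows "total_variation \<rho> A + total_variation \<rho> B \<le> total_variation \<rho> (A \<union> B)"
proof -
  let ?C = "\<lambda>A. {P. finite P \<and> P \<subseteq> sets borel \<and> partition_on A P}"
  let ?S = "\<lambda>P. \<Sum>B\<in>P. ennreal (cmod (\<rho> B))"
  have ne: "?C A \<noteq> {}" if "A \<in> sets borel" for A
  proof -
    have "{A} - {{}} \<in> ?C A" using that by (auto simp: partition_on_def pairwise_def)
    then show ?thesis by blast
  qed
  have *: "?S P + ?S Q \<le> total_variation \<rho> (A \<union> B)" if "P \<in> ?C A" "Q \<in> ?C B" for P Q
  proof -
    have "D \<notin> Q" if D: "D \<in> P" for D
    proof
      assume "D \<in> Q"
      then have "D \<subseteq> A \<inter> B" "D \<noteq> {}"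
        using D \<open>P \<in> ?C A\<close> \<open>Q \<in> ?C B\<close> by (auto simp: partition_on_def)
      then show False using AB by simp
    qed
    then have "P \<inter> Q = {}" by blast
    then have "?S P + ?S Q = ?S (P \<union> Q)"
      using that by (intro sum.union_disjoint[symmetric]) auto
    also have "\<dots> \<le> total_variation \<rho> (A \<union> B)"
    proof (rule total_variation_upper[OF \<rho>])
      show "disjoint (P \<union> Q)"
        using that AB by (intro disjoint_union) (auto simp: partition_on_def)
    qed (use that A B in \<open>auto simp: partition_on_def\<close>)
    finally show ?thesis .
  qed
  have "?S P + total_variation \<rho> B \<le> total_variation \<rho> (A \<union> B)" if "P \<in> ?C A" for P
    unfolding total_variation_def[of \<rho> B] ennreal_SUP_add_right[OF ne[OF B]]
    by (rule SUP_least) (rule *[OF that])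
  then show ?thesis
    unfolding total_variation_def[of \<rho> A] ennreal_SUP_add_left[OF ne[OF A], symmetric]
    by (rule SUP_least)
qed

lemma ennreal_norm_sums_le:
  fixes f :: "nat \<Rightarrow> 'a::real_normed_vector"
  assumes "f sums s"
  shows "ennreal (norm s) \<le> (\<Sum>n. ennreal (norm (f n)))"
proof (rule LIMSEQ_le_const2)
  show "(\<lambda>n. ennreal (norm (\<Sum>i<n. f i))) \<longlonglongrightarrow> ennreal (norm s)"
    using assms by (auto simp: sums_def intro!: tendsto_intros)
  have "ennreal (norm (\<Sum>i<n. f i)) \<le> (\<Sum>n. ennreal (norm (f n)))" for n
  proof -
    have "ennreal (norm (\<Sum>i<n. f i)) \<le> (\<Sum>i<n. ennreal (norm (f i)))"
      by (subst sum_ennreal) (auto intro!: ennreal_leI norm_sum)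
    also have "\<dots> \<le> (\<Sum>n. ennreal (norm (f n)))"
      by (intro sum_le_suminf) auto
    finally show ?thesis .
  qed
  then show "\<exists>N. \<forall>n\<ge>N. ennreal (norm (\<Sum>i<n. f i)) \<le> (\<Sum>n. ennreal (norm (f n)))" by blast
qed

text \<open>
  A block \<open>B\<close> of a partition of the union is cut by the sets \<open>A n\<close>, and
  \<open>|\<rho> B| \<le> (\<Sum>n. |\<rho> (B \<inter> A n)|)\<close>; for fixed \<open>n\<close> the pieces \<open>B \<inter> A n\<close> are disjoint in \<open>A n\<close>.
\<close>

lemma total_variation_countably_subadditive:
  assumes \<rho>: "vector_measure \<rho>" and A: "\<And>n::nat. A n \<in> sets borel" and disj: "disjoint_family A"
  shows "total_variation \<rho> (\<Union>n. A n) \<le> (\<Sum>n. total_variation \<rho> (A n))"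
  unfolding total_variation_def[of \<rho> "\<Union>n. A n"]
proof (rule SUP_least)
  fix P assume "P \<in> {P. finite P \<and> P \<subseteq> sets borel \<and> partition_on (\<Union>n. A n) P}"
  then have P: "finite P" "P \<subseteq> sets borel" "disjoint P" "\<Union>P = (\<Union>n. A n)"
    by (auto simp: partition_on_def)
  have "(\<Sum>B\<in>P. ennreal (cmod (\<rho> B))) \<le> (\<Sum>B\<in>P. \<Sum>n. ennreal (cmod (\<rho> (B \<inter> A n))))"
  proof (rule sum_mono)
    fix B assume B: "B \<in> P"
    have "(\<lambda>n. \<rho> (B \<inter> A n)) sums \<rho> (\<Union>n. B \<inter> A n)"
    proof (rule vector_measure_sums[OF \<rho>])
      show "disjoint_family (\<lambda>n. B \<inter> A n)"
        using disj by (rule disjoint_family_on_bisimulation) auto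
    qed (use B P A in auto)
    moreover have "(\<Union>n. B \<inter> A n) = B" using B P(4) by auto
    ultimately show "ennreal (cmod (\<rho> B)) \<le> (\<Sum>n. ennreal (cmod (\<rho> (B \<inter> A n))))"
      by (metis ennreal_norm_sums_le)
  qed
  also have "\<dots> = (\<Sum>n. \<Sum>B\<in>P. ennreal (cmod (\<rho> (B \<inter> A n))))"
    by (rule suminf_sum[symmetric]) auto
  also have "\<dots> \<le> (\<Sum>n. total_variation \<rho> (A n))"
  proof (intro suminf_le)
    fix n
    have "(\<Sum>B\<in>P. ennreal (cmod (\<rho> (B \<inter> A n)))) = (\<Sum>B\<in>(\<lambda>B. B \<inter> A n) ` P. ennreal (cmod (\<rho> B)))"
    \<comment> \<open>Distinct blocks are disjoint, so their traces on \<open>A n\<close> can coincide only by being empty.\<close>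
    proof (subst sum.reindex_nontrivial[OF P(1)])
      fix B B' assume B: "B \<in> P" "B' \<in> P" "B \<noteq> B'" and eq: "B \<inter> A n = B' \<inter> A n"
      have "B \<inter> B' = {}" using P(3) B by (auto dest: disjointD)
      then have "B \<inter> A n = {}" using eq by blast
      then show "ennreal (cmod (\<rho> (B \<inter> A n))) = 0" by (simp add: vector_measure_empty[OF \<rho>])
    qed simp
    also have "\<dots> \<le> total_variation \<rho> (A n)"
    proof (rule total_variation_upper[OF \<rho> A])
      show "disjoint ((\<lambda>B. B \<inter> A n) ` P)"
        using P(3) unfolding pairwise_image by (auto simp: pairwise_def disjnt_iff)
    qed (use P A in auto)
    finally show "(\<Sum>B\<in>P. ennreal (cmod (\<rho> (B \<inter> A n)))) \<le> total_variation \<rho> (A n)" .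
  qed auto
  finally show "(\<Sum>B\<in>P. ennreal (cmod (\<rho> B))) \<le> (\<Sum>n. total_variation \<rho> (A n))" .
qed

lemma total_variation_countably_additive:
  fixes \<rho> :: "'a::topological_space set \<Rightarrow> complex"
  assumes \<rho>: "vector_measure \<rho>"
  shows "countably_additive (sets borel) (total_variation \<rho>)"
proof (rule countably_additiveI)
  fix A :: "nat \<Rightarrow> 'a set"
  assume "range A \<subseteq> sets borel" and disj: "disjoint_family A"
  then have A: "A n \<in> sets borel" for n by auto
  have fin: "(\<Sum>i<n. total_variation \<rho> (A i)) \<le> total_variation \<rho> (\<Union>i<n. A i)" for n
  proof (induction n)
    case 0
    show ?case by simp
  next
    case (Suc n)
    have "(\<Sum>i<Suc n. total_variation \<rho> (A i))
        \<le> total_variation \<rho> (\<Union>i<n. A i) + total_variation \<rho> (A n)"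
      using Suc by (simp add: add_right_mono)
    also have "\<dots> \<le> total_variation \<rho> ((\<Union>i<n. A i) \<union> A n)"
    proof (rule total_variation_superadditive[OF \<rho> _ A])
      show "(\<Union>i<n. A i) \<inter> A n = {}"
      proof -
        have "A i \<inter> A n = {}" if "i < n" for i
          using disj that by (intro disjoint_family_onD) auto
        then show ?thesis by auto
      qed
    qed (use A in auto)
    finally show ?case by (simp add: lessThan_Suc Un_commute)
  qed
  have "(\<Sum>n. total_variation \<rho> (A n)) \<le> total_variation \<rho> (\<Union>n. A n)"
    unfolding suminf_eq_SUP
  proof (rule SUP_least)
    fix n
    show "(\<Sum>i<n. total_variation \<rho> (A i)) \<le> total_variation \<rho> (\<Union>n. A n)"
      by (rule order_trans[OF fin total_variation_mono[OF \<rho>]]) (use A in auto)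
  qed
  with total_variation_countably_subadditive[OF \<rho> A disj]
  show "(\<Sum>n. total_variation \<rho> (A n)) = total_variation \<rho> (\<Union>n. A n)" by simp
qed

lemma sets_variation_measure [simp, measurable_cong]: "sets (variation_measure \<rho>) = sets borel"
  unfolding variation_measure_def
  using sets.sigma_sets_eq[of borel] by (simp add: sets_measure_of)

lemma space_variation_measure [simp]: "space (variation_measure \<rho>) = UNIV"
  using sets_eq_imp_space_eq[OF sets_variation_measure[of \<rho>]] by simp

text \<open>
  Being countably additive, the total variation is not replaced by the zero measure in the
  definition of \<open>variation_measure\<close>.
\<close>

lemma emeasure_variation_measure:
  assumes \<rho>: "vector_measure \<rho>" and A: "A \<in> sets borel"
  shows "emeasure (variation_measure \<rho>) A = total_variation \<rho> A"
  unfolding variation_measure_def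
proof (rule emeasure_measure_of_sigma)
  show "sigma_algebra UNIV (sets borel)"
    using sets.sigma_algebra_axioms[of borel] by simp
  show "positive (sets borel) (total_variation \<rho>)"
    using vector_measure_empty[OF \<rho>] by (auto simp: positive_def intro!: total_variation_eq_0)
qed (use A total_variation_countably_additive[OF \<rho>] in auto)

text \<open>
  For a real additive set function, the sum of the absolute values over a partition is the value on
  the union of the positive blocks minus the value on the union of the negative ones, hence at most
  \<open>2 C\<close>. The real and the imaginary part contribute once each, which makes \<open>4 C\<close>.
\<close>

lemma total_variation_le_bound:
  assumes \<rho>: "vector_measure \<rho>" and bound: "\<And>B. B \<in> sets borel \<Longrightarrow> cmod (\<rho> B) \<le> C"
  shows "total_variation \<rho> A \<le> ennreal (4 * C)"
  unfolding total_variation_def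
proof (rule SUP_least)
  fix P assume "P \<in> {P. finite P \<and> P \<subseteq> sets borel \<and> partition_on A P}"
  then have P: "finite P" "P \<subseteq> sets borel" "disjoint P" by (auto simp: partition_on_def)
  have part: "(\<Sum>B\<in>P. \<bar>f (\<rho> B)\<bar>) \<le> 2 * C"
    if f: "\<And>z. \<bar>f z\<bar> \<le> cmod z" "bounded_linear f" for f :: "complex \<Rightarrow> real"
  proof -
    have Q: "\<bar>\<Sum>B\<in>Q. f (\<rho> B)\<bar> \<le> C" if "Q \<subseteq> P" for Q
    proof -
      have Q: "finite Q" "Q \<subseteq> sets borel" "disjoint Q"
        using P that by (auto intro: finite_subset pairwise_subset)
      have "(\<Sum>B\<in>Q. f (\<rho> B)) = f (\<rho> (\<Union>Q))"
        using vector_measure_Union[OF vector_measure_compose[OF f(2) \<rho>] Q] by simp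
      moreover have "\<Union>Q \<in> sets borel" using Q by (intro sets.finite_Union)
      ultimately show ?thesis
        using f(1)[of "\<rho> (\<Union>Q)"] bound[of "\<Union>Q"] by simp
    qed
    let ?P = "{B\<in>P. f (\<rho> B) \<ge> 0}" and ?N = "{B\<in>P. \<not> f (\<rho> B) \<ge> 0}"
    have "(\<Sum>B\<in>P. \<bar>f (\<rho> B)\<bar>) = (\<Sum>B\<in>P. if f (\<rho> B) \<ge> 0 then f (\<rho> B) else - f (\<rho> B))"
      by (intro sum.cong) auto
    also have "\<dots> = (\<Sum>B\<in>?P. f (\<rho> B)) + (\<Sum>B\<in>?N. - f (\<rho> B))"
      using P(1) by (simp add: sum.If_cases Int_def)
    also have "\<dots> \<le> C + C"
      using Q[of ?P] Q[of ?N] by (simp add: sum_negf)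
    finally show ?thesis by simp
  qed
  have "(\<Sum>B\<in>P. cmod (\<rho> B)) \<le> (\<Sum>B\<in>P. \<bar>Re (\<rho> B)\<bar> + \<bar>Im (\<rho> B)\<bar>)"
    by (intro sum_mono cmod_le)
  also have "\<dots> \<le> 2 * C + 2 * C"
    unfolding sum.distrib
    by (intro add_mono part abs_Re_le_cmod abs_Im_le_cmod bounded_linear_Re bounded_linear_Im)
  finally show "(\<Sum>B\<in>P. ennreal (cmod (\<rho> B))) \<le> ennreal (4 * C)"
    by (subst sum_ennreal) (auto intro: ennreal_leI)
qed

section \<open>Translations and the norm of integrable functions\<close>

abbreviation variation_along ::
    "('g::topological_space set \<Rightarrow> 'x::complex_banach) \<Rightarrow> ('x \<Rightarrow> complex) \<Rightarrow> 'g measure" where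
  "variation_along \<nu> x' \<equiv> variation_measure (\<lambda>A. x' (\<nu> A))"

lemma complex_dual_linear: "x' \<in> complex_dual \<Longrightarrow> bounded_linear x'"
  by (simp add: complex_dual_def)

lemma dual_ball_dual: "x' \<in> dual_ball \<Longrightarrow> x' \<in> complex_dual"
  by (simp add: dual_ball_def)

lemma dual_ball_scaleC: "x' \<in> dual_ball \<Longrightarrow> x' (c *\<^sub>C x) = c * x' x"
  by (simp add: dual_ball_def complex_dual_def)

lemma dual_ball_le_norm:
  assumes "x' \<in> dual_ball" shows "cmod (x' x) \<le> norm x"
proof -
  have "cmod (x' x) \<le> onorm x' * norm x"
    using assms by (intro onorm) (simp add: dual_ball_def complex_dual_def)
  also have "\<dots> \<le> 1 * norm x"
    using assms by (intro mult_right_mono) (auto simp: dual_ball_def)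
  finally show ?thesis by simp
qed

lemma vector_measure_dual:
  "x' \<in> complex_dual \<Longrightarrow> vector_measure \<nu> \<Longrightarrow> vector_measure (\<lambda>A. x' (\<nu> A))"
  by (rule vector_measure_compose[OF complex_dual_linear])

lemma scaleC_zero_right: "c *\<^sub>C (0::'x::complex_banach) = 0"
  using scaleC_add_right[of c 0 "0::'x"] by simp

lemma scaleC_sum_right: "c *\<^sub>C (\<Sum>i\<in>I. f i) = (\<Sum>i\<in>I. c *\<^sub>C f i)"
  by (induction I rule: infinite_finite_induct) (auto simp: scaleC_zero_right scaleC_add_right)

text \<open>
  The integral may be computed over any finite Borel partition on whose blocks \<open>\<psi>\<close> is constant, which
  need not be the partition into level sets: the blocks of equal value are grouped together.
\<close>

lemma vm_simple_integral_partition: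
  assumes \<nu>: "vector_measure \<nu>"
    and Q: "finite Q" "Q \<subseteq> sets borel" "partition_on UNIV Q"
    and \<psi>: "\<And>B t. B \<in> Q \<Longrightarrow> t \<in> B \<Longrightarrow> \<psi> t = c B"
  shows "vm_simple_integral \<nu> \<psi> = (\<Sum>B\<in>Q. c B *\<^sub>C \<nu> B)"
proof -
  have cover: "\<exists>B\<in>Q. t \<in> B" for t
    using Q(3) by (auto simp: partition_on_def)
  have ne: "B \<noteq> {}" if "B \<in> Q" for B
    using Q(3) that by (auto simp: partition_on_def)
  have range: "range \<psi> = c ` Q"
  proof
    show "range \<psi> \<subseteq> c ` Q" using cover \<psi> by fastforce
    show "c ` Q \<subseteq> range \<psi>"
    proof
      fix y assume "y \<in> c ` Q"
      then obtain B where "B \<in> Q" "y = c B" by blast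
      moreover obtain t where "t \<in> B" using ne[OF \<open>B \<in> Q\<close>] by blast
      ultimately have "y = \<psi> t" using \<psi> by simp
      then show "y \<in> range \<psi>" by simp
    qed
  qed
  have vimage: "\<psi> -` {y} = \<Union>{B\<in>Q. c B = y}" for y
  proof (intro equalityI subsetI)
    fix t assume "t \<in> \<psi> -` {y}"
    moreover obtain B where "B \<in> Q" "t \<in> B" using cover by blast
    ultimately show "t \<in> \<Union>{B\<in>Q. c B = y}" using \<psi> by force
  qed (use \<psi> in auto)
  have meas: "\<nu> (\<psi> -` {y}) = (\<Sum>B\<in>{B\<in>Q. c B = y}. \<nu> B)" for y
    unfolding vimage
  proof (rule vector_measure_Union[OF \<nu>])
    have "disjoint Q" using Q(3) by (simp add: partition_on_def)
    then show "disjoint {B\<in>Q. c B = y}" by (rule pairwise_subset) auto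
  qed (use Q in auto)
  have "vm_simple_integral \<nu> \<psi> = (\<Sum>y\<in>c ` Q. \<Sum>B\<in>{B\<in>Q. c B = y}. c B *\<^sub>C \<nu> B)"
    unfolding vm_simple_integral_def range meas scaleC_sum_right
    by (intro sum.cong) auto
  also have "\<dots> = (\<Sum>B\<in>Q. c B *\<^sub>C \<nu> B)"
    by (rule sum.image_gen[OF Q(1), symmetric])
  finally show ?thesis .
qed

lemma nn_integral_simple_compose:
  assumes \<psi>: "simple_function borel \<psi>" and M: "sets M = sets borel"
  shows "(\<integral>\<^sup>+ t. g (\<psi> t) \<partial>M) = (\<Sum>y\<in>range \<psi>. g y * emeasure M (\<psi> -` {y}))"
proof -
  have fin: "finite (range \<psi>)" and vim: "\<psi> -` {y} \<in> sets M" for y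
    using \<psi> M simple_functionD[OF \<psi>] by auto
  have "g (\<psi> t) = (\<Sum>y\<in>range \<psi>. g y * indicator (\<psi> -` {y}) t)" for t
  proof -
    have "(\<Sum>y\<in>range \<psi>. g y * indicator (\<psi> -` {y}) t) = (\<Sum>y\<in>range \<psi>. if \<psi> t = y then g y else 0)"
      by (intro sum.cong) auto
    then show ?thesis using fin by simp
  qed
  then have "(\<integral>\<^sup>+ t. g (\<psi> t) \<partial>M) = (\<integral>\<^sup>+ t. (\<Sum>y\<in>range \<psi>. g y * indicator (\<psi> -` {y}) t) \<partial>M)"
    by simp
  also have "\<dots> = (\<Sum>y\<in>range \<psi>. \<integral>\<^sup>+ t. g y * indicator (\<psi> -` {y}) t \<partial>M)"
    using vim by (intro nn_integral_sum) auto
  also have "\<dots> = (\<Sum>y\<in>range \<psi>. g y * emeasure M (\<psi> -` {y}))"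
    using vim by (intro sum.cong nn_integral_cmult_indicator) auto
  finally show ?thesis .
qed

text \<open>
  The step that needs the Hahn--Banach theorem: a functional norming the vector \<open>I\<^sub>\<nu>(\<psi>)\<close> bounds it by
  the integral of \<open>|\<psi>|\<close> against a single scalar variation.
\<close>

lemma norm_vm_simple_integral_le:
  assumes \<nu>: "vector_measure \<nu>" and \<psi>: "simple_function borel \<psi>"
  shows "ennreal (norm (vm_simple_integral \<nu> \<psi>)) \<le> vm_norm \<nu> \<psi>"
proof -
  obtain x' where x': "x' \<in> dual_ball"
    and norming: "norm (vm_simple_integral \<nu> \<psi>) \<le> cmod (x' (vm_simple_integral \<nu> \<psi>))"
    using exists_norming_functional by blast
  interpret x': bounded_linear x'
    using x' by (intro complex_dual_linear dual_ball_dual)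
  have \<rho>: "vector_measure (\<lambda>A. x' (\<nu> A))"
    using \<nu> x' by (intro vector_measure_dual dual_ball_dual)
  have vim: "\<psi> -` {y} \<in> sets borel" for y
    using simple_functionD(2)[OF \<psi>, of "{y}"] by simp
  have "x' (vm_simple_integral \<nu> \<psi>) = (\<Sum>y\<in>range \<psi>. y * x' (\<nu> (\<psi> -` {y})))"
    unfolding vm_simple_integral_def by (simp add: x'.sum dual_ball_scaleC[OF x'])
  then have "norm (vm_simple_integral \<nu> \<psi>) \<le> (\<Sum>y\<in>range \<psi>. cmod y * cmod (x' (\<nu> (\<psi> -` {y}))))"
    using norming norm_sum[of "\<lambda>y. y * x' (\<nu> (\<psi> -` {y}))" "range \<psi>"] by (simp add: norm_mult)
  then have "ennreal (norm (vm_simple_integral \<nu> \<psi>))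
      \<le> (\<Sum>y\<in>range \<psi>. ennreal (cmod y) * ennreal (cmod (x' (\<nu> (\<psi> -` {y})))))"
    by (simp add: ennreal_mult[symmetric] sum_ennreal ennreal_leI)
  also have "\<dots> \<le> (\<Sum>y\<in>range \<psi>. ennreal (cmod y) * emeasure (variation_along \<nu> x') (\<psi> -` {y}))"
    using cmod_le_total_variation[OF \<rho> vim]
    by (intro sum_mono mult_left_mono) (auto simp: emeasure_variation_measure[OF \<rho> vim])
  also have "\<dots> = (\<integral>\<^sup>+ t. ennreal (cmod (\<psi> t)) \<partial>variation_along \<nu> x')"
    by (rule nn_integral_simple_compose[OF \<psi>, symmetric]) simp
  also have "\<dots> \<le> vm_norm \<nu> \<psi>"
    unfolding vm_norm_def using x' by (rule SUP_upper)
  finally show ?thesis .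
qed

text \<open>
  A sum of suprema over independent index sets is bounded as soon as all simultaneous choices are.
  The summand \<open>a\<close> carries the terms already chosen through the induction.
\<close>

lemma sum_SUP_le:
  fixes f :: "'i \<Rightarrow> 'j \<Rightarrow> ennreal"
  assumes "finite R" and "\<forall>y\<in>R. C y \<noteq> {}"
    and "\<forall>p. (\<forall>y\<in>R. p y \<in> C y) \<longrightarrow> (\<Sum>y\<in>R. f y (p y)) + a \<le> V"
  shows "(\<Sum>y\<in>R. SUP i\<in>C y. f y i) + a \<le> V"
  using assms
proof (induction R arbitrary: a rule: finite_induct)
  case empty
  then show ?case by simp
next
  case (insert z R)
  have "f z i + ((\<Sum>y\<in>R. SUP i\<in>C y. f y i) + a) \<le> V" if i: "i \<in> C z" for i
  proof -
    have "(\<Sum>y\<in>R. f y (p y)) + (f z i + a) \<le> V" if p: "\<forall>y\<in>R. p y \<in> C y" for p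
    proof -
      have "(\<Sum>y\<in>insert z R. f y ((p(z := i)) y)) + a \<le> V"
        by (rule insert.prems(2)[rule_format, of "p(z := i)"]) (use p i in auto)
      moreover have "(\<Sum>y\<in>R. f y ((p(z := i)) y)) = (\<Sum>y\<in>R. f y (p y))"
        using insert.hyps by (intro sum.cong) auto
      ultimately show ?thesis
        using insert.hyps by (simp add: ac_simps)
    qed
    then have "(\<Sum>y\<in>R. SUP i\<in>C y. f y i) + (f z i + a) \<le> V"
      using insert.prems(1) by (intro insert.IH) blast+
    then show ?thesis by (simp only: ac_simps)
  qed
  then have "(SUP i\<in>C z. f z i + ((\<Sum>y\<in>R. SUP i\<in>C y. f y i) + a)) \<le> V"
    by (rule SUP_least)
  moreover have "(SUP i\<in>C z. f z i + ((\<Sum>y\<in>R. SUP i\<in>C y. f y i) + a))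
      = (SUP i\<in>C z. f z i) + ((\<Sum>y\<in>R. SUP i\<in>C y. f y i) + a)"
    using insert.prems by (intro ennreal_SUP_add_left) auto
  ultimately have "(SUP i\<in>C z. f z i) + ((\<Sum>y\<in>R. SUP i\<in>C y. f y i) + a) \<le> V"
    by (simp only:)
  then show ?case using insert.hyps by (simp add: ac_simps)
qed

lemma continuous_on_left_translation:
  "continuous_on UNIV (\<lambda>t::'g::topological_group_add. s + t)"
  by (intro continuous_intros)

lemma measurable_left_translation [measurable]:
  "(\<lambda>t::'g::topological_group_add. s + t) \<in> borel_measurable borel"
  by (intro borel_measurable_continuous_onI continuous_on_left_translation)

lemma simple_function_left_translation:
  assumes "simple_function borel \<psi>"
  shows "simple_function borel (\<lambda>t::'g::topological_group_add. \<psi> (s + t))"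
  by (rule simple_function_comp[OF measurable_left_translation assms])

text \<open>
  The use of the invariance. The left-hand side is \<open>x'(I\<^sub>\<nu>(\<psi>))\<close> for the simple function \<open>\<psi>\<close> that on
  each block \<open>B\<close> has modulus at most \<open>b B\<close> and the phase conjugate to that of \<open>x'(\<nu>(B))\<close>. Translating \<open>\<psi>\<close>
  back by \<open>s\<close> preserves the norm of the integral and gives a function dominated by \<open>|\<phi>|\<close>.
\<close>

lemma variation_translate_partition_le:
  fixes \<nu> :: "'g::topological_group_add set \<Rightarrow> 'x::complex_banach"
  assumes \<nu>: "vector_measure \<nu>" and inv: "norm_integral_translation_invariant \<nu>"
    and x': "x' \<in> dual_ball"
    and Q: "finite Q" "Q \<subseteq> sets borel" "partition_on UNIV Q"
    and b: "\<And>B t. B \<in> Q \<Longrightarrow> s + t \<in> B \<Longrightarrow> b B \<le> cmod (\<phi> t)" "\<And>B. B \<in> Q \<Longrightarrow> 0 \<le> b B"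
  shows "(\<Sum>B\<in>Q. ennreal (b B) * ennreal (cmod (x' (\<nu> B)))) \<le> vm_norm \<nu> \<phi>"
proof -
  interpret x': bounded_linear x'
    using x' by (intro complex_dual_linear dual_ball_dual)
  define c where "c B = complex_of_real (b B) * cnj (sgn (x' (\<nu> B)))" for B
  define \<psi> where "\<psi> t = (\<Sum>B\<in>Q. c B * indicator B t)" for t
  have \<psi>: "\<psi> t = c B" if "B \<in> Q" "t \<in> B" for B t
  proof -
    have "\<psi> t = (\<Sum>B'\<in>Q. if B' = B then c B' else 0)"
      unfolding \<psi>_def
    proof (rule sum.cong)
      fix B' assume "B' \<in> Q"
      moreover have "disjoint Q" using Q(3) by (simp add: partition_on_def)
      ultimately have "B' \<inter> B = {}" if "B' \<noteq> B"
        using that \<open>B \<in> Q\<close> by (auto dest: disjointD)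
      then show "c B' * indicator B' t = (if B' = B then c B' else 0)"
        using \<open>t \<in> B\<close> by (auto simp: indicator_def)
    qed simp
    then show ?thesis using Q(1) that by simp
  qed
  have simple: "simple_function borel \<psi>"
    unfolding \<psi>_def using Q(2) by (intro simple_function_sum simple_function_mult) auto
  have c_le: "cmod (c B) \<le> b B" if "B \<in> Q" for B
    using b(2)[OF that] by (auto simp: c_def norm_mult norm_sgn)
  have c_ev: "c B * x' (\<nu> B) = b B * cmod (x' (\<nu> B))" for B
  proof -
    have "cnj (sgn z) * z = cmod z" for z
      using complex_norm_square[of z]
      by (cases "z = 0") (auto simp: sgn_eq field_simps power2_eq_square)
    then show ?thesis by (simp add: c_def mult.assoc)
  qed
  have "x' (vm_simple_integral \<nu> \<psi>) = complex_of_real (\<Sum>B\<in>Q. b B * cmod (x' (\<nu> B)))"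
    by (simp add: vm_simple_integral_partition[OF \<nu> Q \<psi>] x'.sum dual_ball_scaleC[OF x'] c_ev)
  then have "\<bar>\<Sum>B\<in>Q. b B * cmod (x' (\<nu> B))\<bar> \<le> norm (vm_simple_integral \<nu> \<psi>)"
    using dual_ball_le_norm[OF x', of "vm_simple_integral \<nu> \<psi>"] by (simp only: norm_of_real)
  then have "(\<Sum>B\<in>Q. b B * cmod (x' (\<nu> B))) \<le> norm (vm_simple_integral \<nu> \<psi>)"
    by simp
  moreover have "(\<Sum>B\<in>Q. ennreal (b B) * ennreal (cmod (x' (\<nu> B))))
      = ennreal (\<Sum>B\<in>Q. b B * cmod (x' (\<nu> B)))"
  proof -
    have "(\<Sum>B\<in>Q. ennreal (b B) * ennreal (cmod (x' (\<nu> B))))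
        = (\<Sum>B\<in>Q. ennreal (b B * cmod (x' (\<nu> B))))"
      using b(2) by (intro sum.cong) (auto simp: ennreal_mult)
    also have "\<dots> = ennreal (\<Sum>B\<in>Q. b B * cmod (x' (\<nu> B)))"
      using b(2) by (intro sum_ennreal) auto
    finally show ?thesis .
  qed
  ultimately have "(\<Sum>B\<in>Q. ennreal (b B) * ennreal (cmod (x' (\<nu> B))))
      \<le> ennreal (norm (vm_simple_integral \<nu> \<psi>))"
    by (simp add: ennreal_leI)
  also have "norm (vm_simple_integral \<nu> \<psi>) = norm (vm_simple_integral \<nu> (\<lambda>t. \<psi> (s + t)))"
  proof -
    have "translate s (\<lambda>t. \<psi> (s + t)) = \<psi>"
      by (simp add: translate_def add.assoc[symmetric])
    then show ?thesis
      using inv simple_function_left_translation[OF simple, of s]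
      unfolding norm_integral_translation_invariant_def by metis
  qed
  also have "ennreal (norm (vm_simple_integral \<nu> (\<lambda>t. \<psi> (s + t)))) \<le> vm_norm \<nu> (\<lambda>t. \<psi> (s + t))"
    by (intro norm_vm_simple_integral_le \<nu> simple_function_left_translation simple)
  also have "\<dots> \<le> vm_norm \<nu> \<phi>"
    unfolding vm_norm_def
  proof (intro SUP_mono' nn_integral_mono ennreal_leI)
    fix t
    have "s + t \<in> \<Union>Q" using Q(3) by (simp add: partition_on_def)
    then obtain B where B: "B \<in> Q" "s + t \<in> B" by blast
    then show "cmod (\<psi> (s + t)) \<le> cmod (\<phi> t)"
      using c_le[OF B(1)] b(1)[OF B] \<psi>[OF B] by simp
  qed
  finally show ?thesis .
qed

text \<open>
  The integral is a finite sum of values \<open>|y|\<close> times total variations of level sets of the translate,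
  and each total variation is a supremum over partitions of its level set. Partitions of the different
  level sets together form a partition of the group on which the translate is constant blockwise.
\<close>

lemma nn_integral_translate_simple_le:
  fixes \<nu> :: "'g::topological_group_add set \<Rightarrow> 'x::complex_banach"
  assumes \<nu>: "vector_measure \<nu>" and inv: "norm_integral_translation_invariant \<nu>"
    and x': "x' \<in> dual_ball" and \<phi>: "simple_function borel \<phi>"
  shows "(\<integral>\<^sup>+ t. ennreal (cmod (\<phi> (- s + t))) \<partial>variation_along \<nu> x') \<le> vm_norm \<nu> \<phi>"
proof -
  have \<rho>: "vector_measure (\<lambda>A. x' (\<nu> A))"
    using \<nu> x' by (intro vector_measure_dual dual_ball_dual)
  define \<phi>s where "\<phi>s t = \<phi> (- s + t)" for t
  have \<phi>s: "simple_function borel \<phi>s"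
    unfolding \<phi>s_def by (rule simple_function_left_translation[OF \<phi>])
  have fin: "finite (range \<phi>s)" and vim: "\<phi>s -` {y} \<in> sets borel" for y
    using simple_functionD[OF \<phi>s] by auto
  let ?C = "\<lambda>A. {P. finite P \<and> P \<subseteq> sets borel \<and> partition_on A P}"
  have "(\<Sum>y\<in>range \<phi>s. SUP P\<in>?C (\<phi>s -` {y}).
      ennreal (cmod y) * (\<Sum>B\<in>P. ennreal (cmod (x' (\<nu> B))))) + 0 \<le> vm_norm \<nu> \<phi>"
  proof (rule sum_SUP_le[OF fin]; intro ballI allI impI)
    fix y
    have "{\<phi>s -` {y}} - {{}} \<in> ?C (\<phi>s -` {y})"
      using vim by (auto simp: partition_on_def pairwise_def)
    then show "?C (\<phi>s -` {y}) \<noteq> {}" by (metis (lifting) empty_iff)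
  next
    fix P assume "\<forall>y\<in>range \<phi>s. P y \<in> ?C (\<phi>s -` {y})"
    then have P: "P y \<in> ?C (\<phi>s -` {y})" if "y \<in> range \<phi>s" for y
      using that by (rule bspec)
    define Q where "Q = (\<Union>y\<in>range \<phi>s. P y)"
    define b where "b B = cmod (\<phi>s (SOME t. t \<in> B))" for B
    have val: "\<phi>s t = y" if "y \<in> range \<phi>s" "B \<in> P y" "t \<in> B" for y B t
      using P[OF that(1)] that by (auto simp: partition_on_def)
    have ne: "B \<noteq> {}" if "y \<in> range \<phi>s" "B \<in> P y" for y B
      using P[OF that(1)] that by (auto simp: partition_on_def)
    have b_eq: "b B = cmod y" if "y \<in> range \<phi>s" "B \<in> P y" for y B
      unfolding b_def using val[OF that] ne[OF that] by (simp add: some_in_eq)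
    have "finite Q"
      unfolding Q_def by (rule finite_UN_I[OF fin]) (use P in auto)
    moreover have "Q \<subseteq> sets borel"
      unfolding Q_def using P by (intro UN_least) auto
    ultimately have Q: "finite Q" "Q \<subseteq> sets borel" .
    have "partition_on UNIV Q"
      unfolding partition_on_def
    proof (intro conjI)
      have "t \<in> \<Union>Q" for t
      proof -
        have "t \<in> \<Union>(P (\<phi>s t))" using P[OF rangeI, of t] by (auto simp: partition_on_def)
        then show ?thesis by (auto simp: Q_def)
      qed
      then show "\<Union>Q = UNIV" by auto
      show "disjoint Q"
      proof (rule disjointI)
        fix B B' assume "B \<in> Q" "B' \<in> Q" and ne': "B \<noteq> B'"
        then obtain y y' where B: "y \<in> range \<phi>s" "B \<in> P y" and B': "y' \<in> range \<phi>s" "B' \<in> P y'"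
          unfolding Q_def by blast
        show "B \<inter> B' = {}"
        proof (cases "y = y'")
          case True
          have "disjoint (P y)" using P[OF B(1)] by (simp add: partition_on_def)
          then show ?thesis using B B' True ne' by (auto dest: disjointD)
        next
          case False
          then show ?thesis using val[OF B] val[OF B'] by blast
        qed
      qed
      show "{} \<notin> Q" using ne by (auto simp: Q_def)
    qed
    have "(\<Sum>y\<in>range \<phi>s. ennreal (cmod y) * (\<Sum>B\<in>P y. ennreal (cmod (x' (\<nu> B)))))
        = (\<Sum>y\<in>range \<phi>s. \<Sum>B\<in>P y. ennreal (b B) * ennreal (cmod (x' (\<nu> B))))"
      unfolding sum_distrib_left by (intro sum.cong refl) (simp add: b_eq)
    also have "\<dots> = (\<Sum>B\<in>Q. ennreal (b B) * ennreal (cmod (x' (\<nu> B))))"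
      unfolding Q_def
    proof (rule sum.UNION_disjoint[symmetric])
      show "\<forall>y\<in>range \<phi>s. finite (P y)" using P by auto
      show "\<forall>y\<in>range \<phi>s. \<forall>y'\<in>range \<phi>s. y \<noteq> y' \<longrightarrow> P y \<inter> P y' = {}"
      proof (intro ballI impI equals0I)
        fix y y' B assume y: "y \<in> range \<phi>s" "y' \<in> range \<phi>s" "y \<noteq> y'" and "B \<in> P y \<inter> P y'"
        then have B: "B \<in> P y" "B \<in> P y'" by auto
        obtain t where "t \<in> B" using ne[OF y(1) B(1)] by blast
        then show False using val[OF y(1) B(1)] val[OF y(2) B(2)] y(3) by blast
      qed
    qed (rule fin)
    also have "\<dots> \<le> vm_norm \<nu> \<phi>"
    proof (rule variation_translate_partition_le[OF \<nu> inv x' Q \<open>partition_on UNIV Q\<close>, where s=s])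
      fix B t assume "B \<in> Q" "s + t \<in> B"
      then obtain y where y: "y \<in> range \<phi>s" "B \<in> P y" by (auto simp: Q_def)
      have "\<phi>s (s + t) = \<phi> t" by (simp add: \<phi>s_def add.assoc[symmetric])
      then show "b B \<le> cmod (\<phi> t)"
        using b_eq[OF y] val[OF y \<open>s + t \<in> B\<close>] by simp
    qed (simp add: b_def)
    finally show "(\<Sum>y\<in>range \<phi>s. ennreal (cmod y) * (\<Sum>B\<in>P y. ennreal (cmod (x' (\<nu> B))))) + 0
        \<le> vm_norm \<nu> \<phi>" by simp
  qed
  then have "(\<Sum>y\<in>range \<phi>s. ennreal (cmod y) * total_variation (\<lambda>A. x' (\<nu> A)) (\<phi>s -` {y}))
      \<le> vm_norm \<nu> \<phi>"
    by (simp add: total_variation_def SUP_mult_left_ennreal)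
  then show ?thesis
    using nn_integral_simple_compose[OF \<phi>s, of "variation_along \<nu> x'" "\<lambda>y. ennreal (cmod y)"]
    by (simp add: emeasure_variation_measure[OF \<rho> vim] \<phi>s_def[symmetric])
qed

text \<open>
  The left-hand side is the limit of its values at simple functions increasing to \<open>u\<close>, by monotone
  convergence, and the right-hand side, the \<open>\<nu>\<close>-norm of \<open>u\<close>, dominates theirs.
\<close>

theorem nn_integral_translate_le:
  fixes \<nu> :: "'g::topological_group_add set \<Rightarrow> 'x::complex_banach" and u :: "'g \<Rightarrow> ennreal"
  assumes \<nu>: "vector_measure \<nu>" and inv: "norm_integral_translation_invariant \<nu>"
    and x': "x' \<in> dual_ball" and u: "u \<in> borel_measurable borel"
  shows "(\<integral>\<^sup>+ t. u (- s + t) \<partial>variation_along \<nu> x')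
      \<le> (SUP x'\<in>dual_ball. \<integral>\<^sup>+ t. u t \<partial>variation_along \<nu> x')"
proof -
  obtain U where U: "\<And>i::nat. simple_function borel (U i)" "incseq U" "\<And>i t. U i t < top"
    "\<And>t. (SUP i. U i t) = u t"
    using borel_measurable_implies_simple_function_sequence'[OF u] by blast
  have Um [measurable]: "U i \<in> borel_measurable borel" for i
    by (rule borel_measurable_simple_function[OF U(1)])
  have "(\<integral>\<^sup>+ t. u (- s + t) \<partial>variation_along \<nu> x')
      = (SUP i. \<integral>\<^sup>+ t. U i (- s + t) \<partial>variation_along \<nu> x')"
    unfolding U(4)[symmetric]
  proof (rule nn_integral_monotone_convergence_SUP)
    show "incseq (\<lambda>i t. U i (- s + t))" using U(2) by (auto simp: incseq_def le_fun_def)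
  qed simp
  also have "\<dots> \<le> (SUP x'\<in>dual_ball. \<integral>\<^sup>+ t. u t \<partial>variation_along \<nu> x')"
  proof (rule SUP_least)
    fix i
    define \<phi> where "\<phi> t = complex_of_real (enn2real (U i t))" for t
    have "simple_function borel \<phi>"
      unfolding \<phi>_def using simple_function_compose[OF U(1)[of i]] by (simp add: comp_def)
    moreover have \<phi>: "ennreal (cmod (\<phi> t)) = U i t" for t
      using U(3)[of i t] by (simp add: \<phi>_def)
    ultimately have "(\<integral>\<^sup>+ t. U i (- s + t) \<partial>variation_along \<nu> x') \<le> vm_norm \<nu> \<phi>"
      using nn_integral_translate_simple_le[OF \<nu> inv x', of \<phi> s] by simp
    also have "\<dots> \<le> (SUP x'\<in>dual_ball. \<integral>\<^sup>+ t. u t \<partial>variation_along \<nu> x')"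
      unfolding vm_norm_def \<phi> U(4)[symmetric]
      by (intro SUP_mono' nn_integral_mono SUP_upper) auto
    finally show "(\<integral>\<^sup>+ t. U i (- s + t) \<partial>variation_along \<nu> x')
        \<le> (SUP x'\<in>dual_ball. \<integral>\<^sup>+ t. u t \<partial>variation_along \<nu> x')" .
  qed
  finally show ?thesis .
qed

section \<open>Averaging over a compact group\<close>

lemma compact_subset_open_rectangles:
  assumes C: "compact C" and W: "open W" and CW: "C \<subseteq> W"
  shows "\<exists>R\<in>sets (borel \<Otimes>\<^sub>M borel). C \<subseteq> R \<and> R \<subseteq> (W :: ('a::topological_space \<times> 'b::topological_space) set)"
proof -
  define \<R> where "\<R> = {A \<times> B |(A::'a set) (B::'b set). open A \<and> open B \<and> A \<times> B \<subseteq> W}"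
  have "C \<subseteq> \<Union>\<R>"
  proof
    fix p assume "p \<in> C"
    then have "p \<in> W" using CW by blast
    then obtain A B where "open A" "open B" "p \<in> A \<times> B" "A \<times> B \<subseteq> W"
      by (rule open_prod_elim[OF W])
    then show "p \<in> \<Union>\<R>" unfolding \<R>_def by blast
  qed
  moreover have "\<forall>R\<in>\<R>. open R" by (auto simp: \<R>_def intro: open_Times)
  ultimately obtain \<F> where \<F>: "\<F> \<subseteq> \<R>" "finite \<F>" "C \<subseteq> \<Union>\<F>"
    using compactE[OF C, of \<R>] by metis
  have "\<R> \<subseteq> sets (borel \<Otimes>\<^sub>M borel)"
    by (auto simp: \<R>_def intro!: pair_measureI)
  then have "\<Union>\<F> \<in> sets (borel \<Otimes>\<^sub>M borel)"
    using \<F> by (intro sets.finite_Union) auto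
  moreover have "\<Union>\<F> \<subseteq> W" using \<F>(1) by (auto simp: \<R>_def)
  ultimately show ?thesis using \<F>(3) by blast
qed

text \<open>
  On a product of spaces that are not second countable an open set need not belong to the product of
  the Borel algebras. In the compact case the set where a continuous function is positive does: it is a countable
  union of compact sets, each of which is covered by finitely many open rectangles inside it.
\<close>

lemma cozero_set_in_product_algebra:
  fixes F :: "'a::topological_space \<times> 'b::topological_space \<Rightarrow> real"
  assumes cpt: "compact (UNIV :: ('a \<times> 'b) set)" and F: "continuous_on UNIV F"
  shows "{p. F p > 0} \<in> sets (borel \<Otimes>\<^sub>M borel)"
proof -
  have opn: "open {p. F p > 0}"
    by (intro open_Collect_less F continuous_intros)
  have "\<exists>R\<in>sets (borel \<Otimes>\<^sub>M borel). {p. inverse (real (Suc n)) \<le> F p} \<subseteq> R \<and> R \<subseteq> {p. F p > 0}" for n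
  proof (rule compact_subset_open_rectangles[OF _ opn])
    have "closed {p. inverse (real (Suc n)) \<le> F p}"
      by (intro closed_Collect_le F continuous_intros)
    from compact_Int_closed[OF cpt this]
    show "compact {p. inverse (real (Suc n)) \<le> F p}" by simp
    show "{p. inverse (real (Suc n)) \<le> F p} \<subseteq> {p. F p > 0}"
      by (auto intro: less_le_trans[of 0 "inverse (real (Suc n))"])
  qed
  then obtain R where R: "\<And>n. R n \<in> sets (borel \<Otimes>\<^sub>M borel)"
    "\<And>n. {p. inverse (real (Suc n)) \<le> F p} \<subseteq> R n" "\<And>n. R n \<subseteq> {p. F p > 0}"
    by metis
  have "{p. F p > 0} = (\<Union>n. R n)"
  proof
    show "{p. F p > 0} \<subseteq> (\<Union>n. R n)"
    proof
      fix p assume "p \<in> {p. F p > 0}"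
      then obtain n where "inverse (real (Suc n)) < F p"
        using reals_Archimedean by auto
      then have "p \<in> R n" using R(2)[of n] less_imp_le by blast
      then show "p \<in> (\<Union>n. R n)" by blast
    qed
  qed (use R(3) in auto)
  then show ?thesis using R(1) by auto
qed

lemma continuous_on_left_quotient:
  "continuous_on UNIV (\<lambda>p::'g::topological_group_add \<times> 'g. - fst p + snd p)"
proof -
  have "continuous_on UNIV (\<lambda>p::'g \<times> 'g. - fst p)"
    unfolding continuous_on_def
    by (intro ballI tendsto_minus tendsto_fst tendsto_ident_at)
  then show ?thesis by (intro continuous_on_add continuous_on_snd continuous_on_id)
qed

text \<open>
  Urysohn's lemma, which applies since a compact Hausdorff space is normal.
\<close>

lemma compact_space_Urysohn:
  fixes K U :: "'g::t2_space set"
  assumes cpt: "compact (UNIV :: 'g set)" and K: "compact K" and U: "open U" and KU: "K \<subseteq> U"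
  shows "\<exists>f::'g \<Rightarrow> real. continuous_on UNIV f \<and> (\<forall>t\<in>K. f t > 0) \<and> (\<forall>t. f t > 0 \<longrightarrow> t \<in> U)"
proof -
  have "Hausdorff_space (euclidean :: 'g topology)"
    unfolding Hausdorff_space_def
  proof (intro allI impI)
    fix x y :: 'g
    assume "x \<in> topspace euclidean \<and> y \<in> topspace euclidean \<and> x \<noteq> y"
    then obtain V W where "open V" "open W" "x \<in> V" "y \<in> W" "V \<inter> W = {}"
      using hausdorff[of x y] by blast
    then show "\<exists>V W. openin euclidean V \<and> openin euclidean W \<and> x \<in> V \<and> y \<in> W \<and> disjnt V W"
      by (auto simp: disjnt_def)
  qed
  moreover have "compact_space (euclidean :: 'g topology)"
    using cpt by (simp add: compact_space_def)
  ultimately have "normal_space (euclidean :: 'g topology)"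
    by (intro compact_Hausdorff_or_regular_imp_normal_space) auto
  moreover have "closedin euclidean (- U)" "closedin euclidean K" "disjnt (- U) K"
    using K U KU by (auto simp: disjnt_def closed_Compl intro: compact_imp_closed)
  ultimately obtain f where f: "continuous_map euclidean euclideanreal f" "f ` (- U) \<subseteq> {0}" "f ` K \<subseteq> {1::real}"
    by (rule Urysohn_lemma_alt)
  have "t \<in> U" if "f t > 0" for t
    using f(2) that by (cases "t \<in> U") auto
  moreover have "f t > 0" if "t \<in> K" for t
    using f(3) that by auto
  ultimately show ?thesis using f(1) by (intro exI[of _ f]) auto
qed

lemma normalized_haar_measureD:
  assumes "normalized_haar_measure m"
  shows haar_sets: "sets m = sets borel"
    and haar_total: "emeasure m UNIV = 1"
    and haar_inner_regular:
      "A \<in> sets borel \<Longrightarrow> emeasure m A = (SUP K\<in>{K. compact K \<and> K \<subseteq> A}. emeasure m K)"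
    and haar_image_translation:
      "A \<in> sets borel \<Longrightarrow> emeasure m ((\<lambda>t. s + t) ` A) = emeasure m A"
  using assms unfolding normalized_haar_measure_def by blast+

lemma haar_space: "normalized_haar_measure m \<Longrightarrow> space m = UNIV"
  using sets_eq_imp_space_eq[OF haar_sets] by simp

lemma haar_finite: "normalized_haar_measure m \<Longrightarrow> finite_measure m"
  by (rule finite_measureI) (simp add: haar_space haar_total)

lemma haar_vimage_translation:
  assumes "normalized_haar_measure m" and "A \<in> sets borel"
  shows "emeasure m ((\<lambda>t. a + t) -` A) = emeasure m A"
proof -
  have "(\<lambda>t. a + t) -` A = (\<lambda>t. - a + t) ` A"
  proof (intro equalityI subsetI)
    fix t assume "t \<in> (\<lambda>t. a + t) -` A"
    then have "a + t \<in> A" "t = - a + (a + t)" by (auto simp: add.assoc[symmetric])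
    then show "t \<in> (\<lambda>t. - a + t) ` A" by blast
  qed (auto simp: add.assoc[symmetric])
  then show ?thesis using haar_image_translation[OF assms] by simp
qed

lemma haar_nn_integral_translation:
  assumes m: "normalized_haar_measure m" and u [measurable]: "u \<in> borel_measurable borel"
  shows "(\<integral>\<^sup>+ t. u (a + t) \<partial>m) = (\<integral>\<^sup>+ t. u t \<partial>m)"
proof -
  have T: "(\<lambda>t. a + t) \<in> measurable m m"
    using measurable_left_translation[of a] measurable_cong_sets[OF haar_sets[OF m] haar_sets[OF m]]
    by simp
  have "distr m m (\<lambda>t. a + t) = m"
  proof (rule measure_eqI)
    fix A assume "A \<in> sets (distr m m (\<lambda>t. a + t))"
    then have "A \<in> sets m" by simp
    then show "emeasure (distr m m (\<lambda>t. a + t)) A = emeasure m A"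
      using haar_vimage_translation[OF m, of A a]
      by (simp add: emeasure_distr[OF T] haar_space[OF m] haar_sets[OF m])
  qed simp
  moreover have "(\<integral>\<^sup>+ t. u t \<partial>distr m m (\<lambda>t. a + t)) = (\<integral>\<^sup>+ t. u (a + t) \<partial>m)"
    by (rule nn_integral_distr[OF T])
      (subst measurable_distr_eq1, subst measurable_cong_sets[OF haar_sets[OF m] refl], rule u)
  ultimately show ?thesis by simp
qed

text \<open>
  The functions to which Tonelli's theorem applies after composition with \<open>(s, t) \<mapsto> - s + t\<close>. For an
  arbitrary Borel function this composition is Borel on the product space, but it may fail to be
  measurable for the product of the Borel algebras.
\<close>

definition quotient_measurable :: "('g::topological_group_add \<Rightarrow> ennreal) \<Rightarrow> bool" where
  "quotient_measurable g \<longleftrightarrow> g \<in> borel_measurable borel \<and>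
     (\<lambda>(s, t). g (- s + t)) \<in> borel_measurable (borel \<Otimes>\<^sub>M borel)"

text \<open>
  By inner regularity \<open>U\<close> is, up to a null set, a countable union of compact sets; enlarging each of
  them inside \<open>U\<close> to the positivity set of a continuous function gives \<open>E\<close>.
\<close>

lemma open_almost_quotient_measurable:
  fixes m :: "'g::{topological_group_add, t2_space} measure"
  assumes cpt: "compact (UNIV :: 'g set)" and m: "normalized_haar_measure m" and U: "open U"
  shows "\<exists>E\<in>sets borel. {p. - fst p + snd p \<in> E} \<in> sets (borel \<Otimes>\<^sub>M borel) \<and>
    (AE t in m. t \<in> U \<longleftrightarrow> t \<in> E)"
proof -
  interpret finite_measure m by (rule haar_finite[OF m])
  note sm = haar_sets[OF m]
  let ?K = "{K. compact K \<and> K \<subseteq> U}"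
  have "emeasure m U = (SUP K\<in>?K. emeasure m K)"
    using U by (intro haar_inner_regular[OF m]) simp
  moreover have "?K \<noteq> {}" by blast
  ultimately obtain f :: "nat \<Rightarrow> ennreal" where
    f: "range f \<subseteq> emeasure m ` ?K" "emeasure m U = (SUP n. f n)"
    using ennreal_Sup_countable_SUP[of "emeasure m ` ?K"] by auto
  then have "\<forall>n. \<exists>K. compact K \<and> K \<subseteq> U \<and> f n = emeasure m K" by blast
  then obtain K where K: "\<And>n. compact (K n)" "\<And>n. K n \<subseteq> U" "\<And>n. f n = emeasure m (K n)"
    by metis
  have Kb: "K n \<in> sets m" for n
    unfolding sm by (intro borel_closed compact_imp_closed K(1))
  have Ub: "U \<in> sets m"
    unfolding sm using U by (rule borel_open)
  have "\<exists>\<phi>. continuous_on UNIV \<phi> \<and> (\<forall>t\<in>K n. \<phi> t > (0::real)) \<and> (\<forall>t. \<phi> t > 0 \<longrightarrow> t \<in> U)" for n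
    by (rule compact_space_Urysohn[OF cpt K(1) U K(2)])
  then obtain \<phi> where \<phi>: "\<And>n. continuous_on UNIV (\<phi> n)"
    "\<And>n t. t \<in> K n \<Longrightarrow> \<phi> n t > (0::real)" "\<And>n t. \<phi> n t > 0 \<Longrightarrow> t \<in> U"
    by metis
  define E where "E = (\<Union>n. {t. \<phi> n t > 0})"
  have "open E" unfolding E_def
    by (intro open_UN ballI open_Collect_less \<phi>(1) continuous_intros)
  then have "E \<in> sets borel" by simp
  moreover have "{p. - fst p + snd p \<in> E} \<in> sets (borel \<Otimes>\<^sub>M borel)"
  proof -
    have "compact (UNIV :: ('g \<times> 'g) set)"
      using compact_Times[OF cpt cpt] by simp
    moreover have "continuous_on UNIV (\<lambda>p. \<phi> n (- fst p + snd p))" for n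
      using continuous_on_compose2[OF \<phi>(1) continuous_on_left_quotient] by simp
    ultimately have "{p. \<phi> n (- fst p + snd p) > 0} \<in> sets (borel \<Otimes>\<^sub>M borel)" for n
      by (rule cozero_set_in_product_algebra)
    moreover have "{p. - fst p + snd p \<in> E} = (\<Union>n. {p. \<phi> n (- fst p + snd p) > 0})"
      by (auto simp: E_def)
    ultimately show ?thesis by auto
  qed
  moreover have "AE t in m. t \<in> U \<longleftrightarrow> t \<in> E"
  proof (rule AE_I')
    have KU: "(\<Union>n. K n) \<in> sets m" "(\<Union>n. K n) \<subseteq> U" using Kb K(2) by auto
    have "emeasure m U \<le> emeasure m (\<Union>n. K n)"
      unfolding f(2) K(3) using Kb KU(1) by (intro SUP_least emeasure_mono) auto
    then have "emeasure m (U - (\<Union>n. K n)) = 0"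
      using KU Ub by (subst emeasure_Diff) (auto simp: diff_eq_0_iff_ennreal less_top[symmetric])
    then show "U - (\<Union>n. K n) \<in> null_sets m" using Ub KU by (auto simp: null_sets_def)
    show "{t \<in> space m. \<not> (t \<in> U \<longleftrightarrow> t \<in> E)} \<subseteq> U - (\<Union>n. K n)"
    proof
      fix t assume "t \<in> {t \<in> space m. \<not> (t \<in> U \<longleftrightarrow> t \<in> E)}"
      then have "t \<in> U" "t \<notin> E" using \<phi>(3) by (auto simp: E_def)
      moreover have "t \<in> E" if "t \<in> K n" for n using \<phi>(2)[OF that] by (auto simp: E_def)
      ultimately show "t \<in> U - (\<Union>n. K n)" by blast
    qed
  qed
  ultimately show ?thesis by blast
qed

text \<open>
  The sets that agree almost everywhere with some \<open>E\<close> as below form a \<open>\<sigma>\<close>-algebra, since preimages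
  and almost everywhere equality respect complements and countable unions.
\<close>

lemma borel_almost_quotient_measurable:
  fixes m :: "'g::{topological_group_add, t2_space} measure"
  assumes cpt: "compact (UNIV :: 'g set)" and m: "normalized_haar_measure m"
    and A: "A \<in> sets borel"
  shows "\<exists>E\<in>sets borel. {p. - fst p + snd p \<in> E} \<in> sets (borel \<Otimes>\<^sub>M borel) \<and>
    (AE t in m. t \<in> A \<longleftrightarrow> t \<in> E)"
proof -
  have "A \<in> sigma_sets UNIV {S::'g set. open S}"
    using A by (simp add: borel_def sets_measure_of)
  then show ?thesis
  proof (induction rule: sigma_sets.induct)
    case (Basic U)
    then show ?case using open_almost_quotient_measurable[OF cpt m] by simp
  next
    case Empty
    show ?case by (intro bexI[of _ "{}"]) auto
  next
    case (Compl A)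
    then obtain E where E: "E \<in> sets borel" "{p. - fst p + snd p \<in> E} \<in> sets (borel \<Otimes>\<^sub>M borel)"
      "AE t in m. t \<in> A \<longleftrightarrow> t \<in> E" by blast
    have "{p. - fst p + snd p \<in> - E} = space (borel \<Otimes>\<^sub>M borel) - {p. - fst p + snd p \<in> E}"
      by (auto simp: space_pair_measure)
    then have "{p. - fst p + snd p \<in> - E} \<in> sets (borel \<Otimes>\<^sub>M borel)"
      using sets.compl_sets[OF E(2)] by simp
    moreover have "AE t in m. t \<in> UNIV - A \<longleftrightarrow> t \<in> - E" using E(3) by eventually_elim auto
    ultimately show ?case using E(1) by (intro bexI[of _ "- E"]) auto
  next
    case (Union A)
    then have "\<forall>i. \<exists>E. E \<in> sets borel \<and> {p. - fst p + snd p \<in> E} \<in> sets (borel \<Otimes>\<^sub>M borel) \<and>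
        (AE t in m. t \<in> A i \<longleftrightarrow> t \<in> E)" by blast
    from choice[OF this] obtain E where E: "\<And>i. E i \<in> sets borel"
      "\<And>i. {p. - fst p + snd p \<in> E i} \<in> sets (borel \<Otimes>\<^sub>M borel)"
      "\<And>i. AE t in m. t \<in> A i \<longleftrightarrow> t \<in> E i" by blast
    have "{p. - fst p + snd p \<in> (\<Union>i. E i)} = (\<Union>i. {p. - fst p + snd p \<in> E i})" by auto
    then have "{p. - fst p + snd p \<in> (\<Union>i. E i)} \<in> sets (borel \<Otimes>\<^sub>M borel)" using E(2) by auto
    moreover have "AE t in m. \<forall>i. t \<in> A i \<longleftrightarrow> t \<in> E i" using E(3) by (simp add: AE_all_countable)
    then have "AE t in m. t \<in> (\<Union>i. A i) \<longleftrightarrow> t \<in> (\<Union>i. E i)" by eventually_elim auto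
    ultimately show ?case using E(1) by (intro bexI[of _ "\<Union>i. E i"]) auto
  qed
qed

lemma AE_eq_quotient_measurable:
  fixes m :: "'g::{topological_group_add, t2_space} measure"
  assumes cpt: "compact (UNIV :: 'g set)" and m: "normalized_haar_measure m"
    and u: "u \<in> borel_measurable borel"
  shows "\<exists>g. quotient_measurable g \<and> (AE t in m. u t = g t)"
  using u
proof (induction u rule: borel_measurable_induct)
  case (cong f g)
  then show ?case by simp
next
  case (set A)
  obtain E where E: "E \<in> sets borel" "{p. - fst p + snd p \<in> E} \<in> sets (borel \<Otimes>\<^sub>M borel)"
    "AE t in m. t \<in> A \<longleftrightarrow> t \<in> E"
    using borel_almost_quotient_measurable[OF cpt m set] by blast
  have "(\<lambda>(s, t). indicator E (- s + t)) = (indicator {p. - fst p + snd p \<in> E} :: _ \<Rightarrow> ennreal)"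
    by (auto simp: fun_eq_iff indicator_def)
  then have "quotient_measurable (indicator E)"
    using E by (simp add: quotient_measurable_def)
  moreover have "AE t in m. indicator A t = (indicator E t :: ennreal)"
    using E(3) by eventually_elim (auto simp: indicator_def)
  ultimately show ?case by blast
next
  case (mult u c)
  then obtain g where g: "quotient_measurable g" "AE t in m. u t = g t" by blast
  have "quotient_measurable (\<lambda>t. c * g t)"
    using g(1) by (auto simp: quotient_measurable_def case_prod_unfold)
  moreover have "AE t in m. c * u t = c * g t" using g(2) by eventually_elim simp
  ultimately show ?case by blast
next
  case (add u v)
  then obtain g h where g: "quotient_measurable g" "AE t in m. u t = g t"
    and h: "quotient_measurable h" "AE t in m. v t = h t" by blast
  have "quotient_measurable (\<lambda>t. h t + g t)"
    using g(1) h(1) by (auto simp: quotient_measurable_def case_prod_unfold)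
  moreover have "AE t in m. v t + u t = h t + g t" using g(2) h(2) by eventually_elim simp
  ultimately show ?case by blast
next
  case (seq U)
  then have "\<forall>i. \<exists>g. quotient_measurable g \<and> (AE t in m. U i t = g t)" by blast
  from choice[OF this] obtain g where
    g: "\<And>i. quotient_measurable (g i)" "\<And>i. AE t in m. U i t = g i t"
    by blast
  have "g i \<in> borel_measurable borel"
    "(\<lambda>p. g i (- fst p + snd p)) \<in> borel_measurable (borel \<Otimes>\<^sub>M borel)" for i
    using g(1)[of i] by (simp_all add: quotient_measurable_def case_prod_unfold)
  then have "quotient_measurable (\<lambda>t. SUP i. g i t)"
    unfolding quotient_measurable_def case_prod_unfold
    by (intro conjI borel_measurable_SUP) auto
  moreover have "AE t in m. \<forall>i. U i t = g i t" using g(2) by (simp add: AE_all_countable)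
  then have "AE t in m. (SUP i. U i) t = (SUP i. g i t)" by eventually_elim (simp add: SUP_apply image_comp)
  ultimately show ?case by blast
qed

text \<open>
  After exchanging the integrals, the left invariance of \<open>m\<close> turns the inner integral over \<open>s\<close> into
  a constant: replacing \<open>s\<close> by \<open>t + s\<close> changes \<open>- s + t\<close> into \<open>- s\<close>.
\<close>

lemma quotient_measurable_translation_average:
  assumes m: "normalized_haar_measure m" and \<rho>: "finite_measure \<rho>" "sets \<rho> = sets borel"
    and g: "quotient_measurable g"
  shows "(\<integral>\<^sup>+ s. \<integral>\<^sup>+ t. g (- s + t) \<partial>\<rho> \<partial>m) = (\<integral>\<^sup>+ s. g (- s) \<partial>m) * emeasure \<rho> UNIV"
proof -
  interpret m: finite_measure m by (rule haar_finite[OF m])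
  interpret \<rho>: finite_measure \<rho> by (rule \<rho>(1))
  interpret pair_sigma_finite m \<rho> by standard
  have gm: "g \<in> borel_measurable borel"
    and "(\<lambda>(s, t). g (- s + t)) \<in> borel_measurable (borel \<Otimes>\<^sub>M borel)"
    using g by (auto simp: quotient_measurable_def)
  then have gp: "(\<lambda>(s, t). g (- s + t)) \<in> borel_measurable (m \<Otimes>\<^sub>M \<rho>)"
    by (subst measurable_cong_sets[OF sets_pair_measure_cong[OF haar_sets[OF m] \<rho>(2)] refl])
  have inner: "(\<integral>\<^sup>+ s. g (- s + t) \<partial>m) = (\<integral>\<^sup>+ s. g (- s) \<partial>m)" for t
  proof -
    have "(\<lambda>s. - s + t) \<in> borel_measurable borel"
      by (intro borel_measurable_continuous_onI continuous_on_add continuous_on_const)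
         (auto simp: continuous_on_def intro!: tendsto_minus tendsto_ident_at)
    then have "(\<lambda>s. g (- s + t)) \<in> borel_measurable borel"
      using gm by (rule measurable_compose)
    from haar_nn_integral_translation[OF m this, of t]
    show ?thesis by (simp add: minus_add add.assoc)
  qed
  have "(\<integral>\<^sup>+ s. \<integral>\<^sup>+ t. g (- s + t) \<partial>\<rho> \<partial>m) = (\<integral>\<^sup>+ t. \<integral>\<^sup>+ s. g (- s + t) \<partial>m \<partial>\<rho>)"
    using Fubini'[of "\<lambda>s t. g (- s + t)"] gp by simp
  also have "\<dots> = (\<integral>\<^sup>+ s. g (- s) \<partial>m) * emeasure \<rho> (space \<rho>)"
    by (simp add: inner)
  also have "space \<rho> = UNIV" using sets_eq_imp_space_eq[OF \<rho>(2)] by simp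
  finally show ?thesis .
qed

text \<open>
  The average over all translates of the \<open>\<rho>\<close>-integral of \<open>u\<close>. The case \<open>\<rho> = m\<close> of the preceding lemma
  shows that \<open>m\<close> is invariant under inversion, which identifies its constant. Changing \<open>u\<close> on an
  \<open>m\<close>-null set does not affect the inner integrals, because the translates of the null set are
  \<open>m\<close>-null, hence \<open>\<rho>\<close>-null.
\<close>

theorem translation_average:
  fixes m \<rho> :: "'g::{topological_group_add, t2_space} measure"
  assumes cpt: "compact (UNIV :: 'g set)" and m: "normalized_haar_measure m"
    and \<rho>: "finite_measure \<rho>" "sets \<rho> = sets borel"
    and ac: "\<And>N. N \<in> sets borel \<Longrightarrow> emeasure m N = 0 \<Longrightarrow> emeasure \<rho> N = 0"
    and u: "u \<in> borel_measurable borel"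
  shows "(\<integral>\<^sup>+ s. \<integral>\<^sup>+ t. u (- s + t) \<partial>\<rho> \<partial>m) = (\<integral>\<^sup>+ t. u t \<partial>m) * emeasure \<rho> UNIV"
proof -
  obtain g where g: "quotient_measurable g" and ug: "AE t in m. u t = g t"
    using AE_eq_quotient_measurable[OF cpt m u] by blast
  have gm: "g \<in> borel_measurable borel" using g by (simp add: quotient_measurable_def)
  have "(\<integral>\<^sup>+ s. g (- s) \<partial>m) = (\<integral>\<^sup>+ s. \<integral>\<^sup>+ t. g (- s + t) \<partial>m \<partial>m)"
    using quotient_measurable_translation_average[OF m haar_finite[OF m] haar_sets[OF m] g]
    by (simp add: haar_total[OF m])
  also have "\<dots> = (\<integral>\<^sup>+ t. g t \<partial>m)"
    by (simp add: haar_nn_integral_translation[OF m gm] haar_space[OF m] haar_total[OF m])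
  also have "\<dots> = (\<integral>\<^sup>+ t. u t \<partial>m)"
    using ug by (intro nn_integral_cong_AE) auto
  finally have inv: "(\<integral>\<^sup>+ s. g (- s) \<partial>m) = (\<integral>\<^sup>+ t. u t \<partial>m)" .
  obtain N where N: "{t \<in> space m. u t \<noteq> g t} \<subseteq> N" "emeasure m N = 0" "N \<in> sets m"
    using ug by (auto elim: AE_E)
  have "(\<integral>\<^sup>+ t. u (- s + t) \<partial>\<rho>) = (\<integral>\<^sup>+ t. g (- s + t) \<partial>\<rho>)" for s
  proof (rule nn_integral_cong_AE, rule AE_I')
    have Nb: "N \<in> sets borel" using N(3) haar_sets[OF m] by simp
    have "(\<lambda>t. - s + t) -` N \<in> sets borel"
      using measurable_sets[OF measurable_left_translation Nb] by simp
    moreover have "emeasure m ((\<lambda>t. - s + t) -` N) = 0"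
      using haar_vimage_translation[OF m Nb] N(2) by simp
    ultimately show "(\<lambda>t. - s + t) -` N \<in> null_sets \<rho>"
      using ac \<rho>(2) by (auto simp: null_sets_def)
    show "{t \<in> space \<rho>. u (- s + t) \<noteq> g (- s + t)} \<subseteq> (\<lambda>t. - s + t) -` N"
      using N(1) haar_space[OF m] by auto
  qed
  then show ?thesis
    using quotient_measurable_translation_average[OF m \<rho> g] inv by simp
qed

section \<open>The density of the Haar measure\<close>

lemma abs_cont_vm_null:
  assumes ac: "abs_cont_vm \<nu> \<mu>" and \<mu>: "sets \<mu> = sets borel"
    and N: "N \<in> sets borel" "emeasure \<mu> N = 0" and B: "B \<in> sets borel" "B \<subseteq> N"
  shows "\<nu> B = 0"
proof -
  have "emeasure \<mu> B = 0"
    using emeasure_mono[of B N \<mu>] N B \<mu> by simp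
  then have "norm (\<nu> B) < \<epsilon>" if "\<epsilon> > 0" for \<epsilon>
    using ac that B(1) unfolding abs_cont_vm_def by fastforce
  then show ?thesis
    by (metis norm_le_zero_iff not_less less_irrefl)
qed

lemma variation_along_null:
  assumes \<nu>: "vector_measure \<nu>" and ac: "abs_cont_vm \<nu> \<mu>" and \<mu>: "sets \<mu> = sets borel"
    and x': "x' \<in> complex_dual" and N: "N \<in> sets borel" "emeasure \<mu> N = 0"
  shows "emeasure (variation_along \<nu> x') N = 0"
  unfolding emeasure_variation_measure[OF vector_measure_dual[OF x' \<nu>] N(1)]
proof (rule total_variation_eq_0)
  interpret x': bounded_linear x' by (rule complex_dual_linear[OF x'])
  fix B assume "B \<in> sets borel" "B \<subseteq> N"
  then show "x' (\<nu> B) = 0"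
    using abs_cont_vm_null[OF ac \<mu> N] by (simp add: x'.zero)
qed

lemma semivariation_finite:
  assumes \<nu>: "vector_measure \<nu>"
  shows "semivariation \<nu> A < \<infinity>"
proof -
  obtain C where C: "\<And>B. B \<in> sets borel \<Longrightarrow> norm (\<nu> B) \<le> C"
    using vector_measure_bounded[OF \<nu>] by blast
  have "semivariation \<nu> A \<le> ennreal (4 * C)"
    unfolding semivariation_def
  proof (rule SUP_least)
    fix x' :: "'b \<Rightarrow> complex" assume x': "x' \<in> dual_ball"
    show "total_variation (\<lambda>B. x' (\<nu> B)) A \<le> ennreal (4 * C)"
    proof (rule total_variation_le_bound[OF vector_measure_dual[OF dual_ball_dual[OF x'] \<nu>]])
      fix B :: "'a set" assume "B \<in> sets borel"
      then show "cmod (x' (\<nu> B)) \<le> C"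
        using dual_ball_le_norm[OF x', of "\<nu> B"] C[of B] by linarith
    qed
  qed
  then show ?thesis by (rule le_less_trans) simp
qed

lemma semivariation_eq_SUP_emeasure:
  assumes \<nu>: "vector_measure \<nu>" and A: "A \<in> sets borel"
  shows "semivariation \<nu> A = (SUP x'\<in>dual_ball. emeasure (variation_along \<nu> x') A)"
  unfolding semivariation_def
  using emeasure_variation_measure[OF vector_measure_dual[OF dual_ball_dual \<nu>] A]
  by (intro SUP_cong) auto

lemma norm_le_semivariation:
  assumes \<nu>: "vector_measure \<nu>" and A: "A \<in> sets borel"
  shows "ennreal (norm (\<nu> A)) \<le> semivariation \<nu> A"
proof -
  obtain x' where x': "x' \<in> dual_ball" "norm (\<nu> A) \<le> cmod (x' (\<nu> A))"
    using exists_norming_functional by blast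
  have "ennreal (norm (\<nu> A)) \<le> ennreal (cmod (x' (\<nu> A)))"
    using x'(2) by (rule ennreal_leI)
  also have "\<dots> \<le> total_variation (\<lambda>B. x' (\<nu> B)) A"
    by (rule cmod_le_total_variation[OF vector_measure_dual[OF dual_ball_dual[OF x'(1)] \<nu>] A])
  also have "\<dots> \<le> semivariation \<nu> A"
    unfolding semivariation_def using x'(1) by (rule SUP_upper)
  finally show ?thesis .
qed

lemma semivariation_UNIV_pos:
  assumes \<nu>: "vector_measure \<nu>" and nz: "\<exists>A\<in>sets borel. \<nu> A \<noteq> 0"
  shows "semivariation \<nu> UNIV > 0"
proof -
  obtain A where A: "A \<in> sets borel" "\<nu> A \<noteq> 0" using nz by blast
  then have "0 < ennreal (norm (\<nu> A))" by simp
  also have "\<dots> \<le> semivariation \<nu> A" by (rule norm_le_semivariation[OF \<nu> A(1)])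
  also have "\<dots> \<le> semivariation \<nu> UNIV"
    unfolding semivariation_def
    using total_variation_mono[OF vector_measure_dual[OF dual_ball_dual \<nu>] subset_UNIV]
    by (intro SUP_mono) auto
  finally show ?thesis .
qed

lemma vm_norm_const:
  assumes \<nu>: "vector_measure \<nu>"
  shows "vm_norm \<nu> (\<lambda>_. c) = ennreal (cmod c) * semivariation \<nu> UNIV"
  unfolding vm_norm_def semivariation_eq_SUP_emeasure[OF \<nu> sets.top[of borel, unfolded space_borel]]
  by (simp add: SUP_mult_left_ennreal)

text \<open>
  The inequality \<open>\<parallel>\<nu>\<parallel> \<integral>u dm \<le> N(u)\<close>, where \<open>N(u)\<close> denotes the right-hand side, the \<open>\<nu>\<close>-norm of \<open>u\<close>.
  Every translate of \<open>u\<close> has an integral of at most \<open>N(u)\<close> against \<open>|\<langle>\<nu>, x'\<rangle>|\<close>, hence so has the average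
  over all translates, which is \<open>\<integral>u dm\<close> times the total mass of that measure. The supremum over \<open>x'\<close>
  turns the masses into \<open>\<parallel>\<nu>\<parallel>\<close>.
\<close>

theorem semivariation_mult_haar_integral_le:
  fixes m :: "'g::{topological_group_add, t2_space} measure" and \<nu> :: "'g set \<Rightarrow> 'x::complex_banach"
  assumes cpt: "compact (UNIV :: 'g set)" and m: "normalized_haar_measure m"
    and \<nu>: "vector_measure \<nu>" and ac: "abs_cont_vm \<nu> m"
    and inv: "norm_integral_translation_invariant \<nu>" and u: "u \<in> borel_measurable borel"
  shows "semivariation \<nu> UNIV * (\<integral>\<^sup>+ t. u t \<partial>m)
      \<le> (SUP x'\<in>dual_ball. \<integral>\<^sup>+ t. u t \<partial>variation_along \<nu> x')" (is "_ \<le> ?N")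
proof -
  have "emeasure (variation_along \<nu> x') UNIV * (\<integral>\<^sup>+ t. u t \<partial>m) \<le> ?N" if x': "x' \<in> dual_ball" for x'
  proof -
    let ?\<rho> = "variation_along \<nu> x'"
    have "emeasure ?\<rho> UNIV \<le> semivariation \<nu> UNIV"
      unfolding semivariation_eq_SUP_emeasure[OF \<nu> sets.top[of borel, unfolded space_borel]]
      using x' by (rule SUP_upper)
    then have fin: "finite_measure ?\<rho>"
      using semivariation_finite[OF \<nu>, of UNIV] by (intro finite_measureI) (auto simp: top_unique)
    have "emeasure ?\<rho> UNIV * (\<integral>\<^sup>+ t. u t \<partial>m) = (\<integral>\<^sup>+ s. \<integral>\<^sup>+ t. u (- s + t) \<partial>?\<rho> \<partial>m)"
      using translation_average[OF cpt m fin _ _ u]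
        variation_along_null[OF \<nu> ac haar_sets[OF m] dual_ball_dual[OF x']]
      by (simp add: mult.commute)
    also have "\<dots> \<le> (\<integral>\<^sup>+ s. ?N \<partial>m)"
      by (intro nn_integral_mono nn_integral_translate_le[OF \<nu> inv x' u])
    also have "\<dots> = ?N"
      by (simp add: haar_space[OF m] haar_total[OF m])
    finally show ?thesis .
  qed
  then show ?thesis
    unfolding semivariation_eq_SUP_emeasure[OF \<nu> sets.top[of borel, unfolded space_borel]] SUP_mult_right_ennreal
    by (rule SUP_least)
qed

text \<open>
  The density \<open>h = dm/d\<mu>\<close> exists because a \<open>\<mu>\<close>-null set \<open>N\<close> is \<open>\<nu>\<close>-null, so that its indicator has
  \<open>\<nu>\<close>-norm \<open>0\<close> and the preceding inequality gives \<open>m(N) = 0\<close>. It is positive because the set where it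
  vanishes is \<open>m\<close>-null, hence \<open>\<mu>\<close>-null. Integrating \<open>|f h|\<close> against \<open>\<mu>\<close> is integrating \<open>|f|\<close> against \<open>m\<close>,
  so the same inequality bounds the norm of \<open>h\<close>, and a constant function attains the bound.
\<close>

theorem theorem4p1:
  fixes m \<mu> :: "'g::{topological_group_add, t2_space} measure"
    and \<nu> :: "'g set \<Rightarrow> 'x::complex_banach"
  assumes "compact (UNIV :: 'g set)"
    and "normalized_haar_measure m"
    and "vector_measure \<nu>"
    and "\<exists>A\<in>sets borel. \<nu> A \<noteq> 0"
    and "abs_cont_vm \<nu> m"
    and "norm_integral_translation_invariant \<nu>"
    and "rybakov_control_measure \<nu> \<mu>"
  shows "\<exists>h :: 'g \<Rightarrow> real.
           (\<lambda>t. complex_of_real (h t)) \<in> kothe_dual \<nu> \<mu> \<and>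
           (AE t in \<mu>. h t > 0) \<and>
           kothe_norm \<nu> \<mu> (\<lambda>t. complex_of_real (h t)) = inverse (semivariation \<nu> UNIV) \<and>
           (\<forall>A\<in>sets borel. measure m A = (LINT t:A|\<mu>. h t))"
proof -
  note cpt = assms(1) and m = assms(2) and \<nu> = assms(3) and nz = assms(4) and ac = assms(5)
    and inv = assms(6)
  obtain x0 where x0: "x0 \<in> complex_dual" and \<mu>_def: "\<mu> = variation_along \<nu> x0"
    and fin: "finite_measure \<mu>" and ac\<mu>: "abs_cont_vm \<nu> \<mu>"
    using assms(7) by (auto simp: rybakov_control_measure_def)
  interpret finite_measure \<mu> by (rule fin)
  have s\<mu>: "sets \<mu> = sets borel" by (simp add: \<mu>_def)
  have sm: "sets m = sets borel" by (rule haar_sets[OF m])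
  have meas\<mu>: "f \<in> borel_measurable \<mu> \<longleftrightarrow> f \<in> borel_measurable borel"
    for f :: "'g \<Rightarrow> 'c::topological_space"
    by (simp only: measurable_cong_sets[OF s\<mu> refl])
  \<comment> \<open>The semivariation is finite and positive; a real \<open>r\<close> makes its inverse computable.\<close>
  obtain r where S: "semivariation \<nu> UNIV = ennreal r" and r: "r > 0"
    using semivariation_finite[OF \<nu>, of UNIV] semivariation_UNIV_pos[OF \<nu> nz]
    by (cases "semivariation \<nu> UNIV") auto
  have key: "ennreal r * (\<integral>\<^sup>+ t. ennreal (cmod (f t)) \<partial>m) \<le> vm_norm \<nu> f"
    if "f \<in> borel_measurable borel" for f
    unfolding vm_norm_def S[symmetric]
    using that by (intro semivariation_mult_haar_integral_le[OF cpt m \<nu> ac inv]) measurable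
  have "emeasure m N = 0" if N: "N \<in> sets borel" "emeasure \<mu> N = 0" for N
  proof -
    have "vm_norm \<nu> (indicator N) = (SUP x'\<in>(dual_ball :: ('x \<Rightarrow> complex) set). 0)"
      unfolding vm_norm_def
    proof (rule SUP_cong[OF refl])
      fix x' :: "'x \<Rightarrow> complex" assume x': "x' \<in> dual_ball"
      have "(\<integral>\<^sup>+ t. ennreal (cmod (indicator N t)) \<partial>variation_along \<nu> x')
          = (\<integral>\<^sup>+ t. indicator N t \<partial>variation_along \<nu> x')"
        by (intro nn_integral_cong) (simp add: indicator_def)
      also have "\<dots> = 0"
        using variation_along_null[OF \<nu> ac\<mu> s\<mu> dual_ball_dual[OF x'] N] N(1) by simp
      finally show "(\<integral>\<^sup>+ t. ennreal (cmod (indicator N t)) \<partial>variation_along \<nu> x') = 0" .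
    qed
    also have "\<dots> \<le> 0" by (rule SUP_least) simp
    finally have "ennreal r * (\<integral>\<^sup>+ t. ennreal (cmod (indicator N t)) \<partial>m) \<le> 0"
      using key[of "indicator N"] N(1) by simp
    moreover have "(\<integral>\<^sup>+ t. ennreal (cmod (indicator N t)) \<partial>m) = (\<integral>\<^sup>+ t. indicator N t \<partial>m)"
      by (intro nn_integral_cong) (simp add: indicator_def)
    ultimately show ?thesis using r N(1) sm by simp
  qed
  then have "absolutely_continuous \<mu> m"
    by (auto simp: absolutely_continuous_def null_sets_def s\<mu> sm)
  then obtain k where k: "k \<in> borel_measurable \<mu>" and dens: "density \<mu> k = m"
    using Radon_Nikodym[of m] sm s\<mu> by auto
  have em: "emeasure m A = (\<integral>\<^sup>+ t. k t * indicator A t \<partial>\<mu>)" if "A \<in> sets borel" for A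
    using emeasure_density[OF k, of A] that by (simp add: dens s\<mu>)
  define h where "h t = enn2real (k t)" for t
  have hm: "h \<in> borel_measurable borel" and h0: "h t \<ge> 0" for t
    using k unfolding h_def by (auto simp: meas\<mu>)
  have "(\<integral>\<^sup>+ t. k t \<partial>\<mu>) = 1"
    using em[of UNIV] by (simp add: haar_total[OF m])
  then have "AE t in \<mu>. k t \<noteq> \<infinity>"
    using k by (intro nn_integral_noteq_infinite) auto
  then have hk: "AE t in \<mu>. k t = ennreal (h t)"
    by eventually_elim (simp add: h_def less_top)
  have hm_int: "(\<integral>\<^sup>+ t. ennreal (cmod (f t * complex_of_real (h t))) \<partial>\<mu>) = (\<integral>\<^sup>+ t. ennreal (cmod (f t)) \<partial>m)"
    if f: "f \<in> borel_measurable borel" for f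
  proof -
    have "(\<integral>\<^sup>+ t. ennreal (cmod (f t)) \<partial>m) = (\<integral>\<^sup>+ t. k t * ennreal (cmod (f t)) \<partial>\<mu>)"
      unfolding dens[symmetric] using k f by (intro nn_integral_density) (auto simp: meas\<mu>)
    also have "\<dots> = (\<integral>\<^sup>+ t. ennreal (cmod (f t * complex_of_real (h t))) \<partial>\<mu>)"
      using hk by (intro nn_integral_cong_AE, eventually_elim)
        (simp add: norm_mult h0 ennreal_mult mult.commute)
    finally show ?thesis by simp
  qed
  have "(\<lambda>t. complex_of_real (h t)) \<in> kothe_dual \<nu> \<mu>"
    unfolding kothe_dual_def
  proof (intro CollectI conjI ballI)
    show "(\<lambda>t. complex_of_real (h t)) \<in> borel_measurable borel" using hm by simp
    fix f assume "f \<in> L1_vm \<nu>"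
    then have f: "f \<in> borel_measurable borel" and "vm_norm \<nu> f < \<infinity>"
      by (auto simp: L1_vm_def L1_weak_def)
    then have "ennreal r * (\<integral>\<^sup>+ t. ennreal (cmod (f t)) \<partial>m) < \<infinity>"
      using key[OF f] by (simp add: le_less_trans)
    then have "(\<integral>\<^sup>+ t. ennreal (cmod (f t)) \<partial>m) < \<infinity>"
      using r by (auto simp: ennreal_mult_less_top)
    then show "integrable \<mu> (\<lambda>t. f t * complex_of_real (h t))"
      using f hm hm_int[OF f] by (intro integrableI_bounded) (simp_all add: meas\<mu>)
  qed
  moreover have "AE t in \<mu>. h t > 0"
  proof -
    define Z where "Z = {t. k t = 0}"
    have Z: "Z \<in> sets borel"
      using measurable_sets[OF k, of "{0}"] s\<mu> by (simp add: Z_def vimage_def \<mu>_def)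
    have "emeasure m Z = (\<integral>\<^sup>+ t. 0 \<partial>\<mu>)"
      unfolding em[OF Z] by (intro nn_integral_cong) (auto simp: Z_def indicator_def)
    then have "emeasure \<mu> Z = 0"
      using variation_along_null[OF \<nu> ac sm x0 Z] by (simp add: \<mu>_def)
    then have "AE t in \<mu>. t \<notin> Z"
      using Z s\<mu> by (intro AE_not_in) (auto simp: null_sets_def)
    with hk show ?thesis
    proof eventually_elim
      case (elim t)
      then have "h t \<noteq> 0" by (auto simp: Z_def)
      then show ?case using h0[of t] by simp
    qed
  qed
  moreover have "kothe_norm \<nu> \<mu> (\<lambda>t. complex_of_real (h t)) = inverse (semivariation \<nu> UNIV)"
  proof (rule antisym)
    have inv_r: "inverse (semivariation \<nu> UNIV) = ennreal (inverse r)"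
      unfolding S using r by (rule inverse_ennreal)
    have cancel: "ennreal (inverse r) * ennreal r = 1"
      using r by (simp add: ennreal_mult[symmetric])
    show "kothe_norm \<nu> \<mu> (\<lambda>t. complex_of_real (h t)) \<le> inverse (semivariation \<nu> UNIV)"
      unfolding kothe_norm_def
    proof (rule SUP_least)
      fix f assume "f \<in> {f \<in> L1_vm \<nu>. vm_norm \<nu> f \<le> 1}"
      then have f: "f \<in> borel_measurable borel" and "vm_norm \<nu> f \<le> 1"
        by (auto simp: L1_vm_def L1_weak_def)
      then have "ennreal r * (\<integral>\<^sup>+ t. ennreal (cmod (f t)) \<partial>m) \<le> 1"
        using key[OF f] by simp
      then have "ennreal (inverse r) * (ennreal r * (\<integral>\<^sup>+ t. ennreal (cmod (f t)) \<partial>m))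
          \<le> ennreal (inverse r) * 1"
        by (rule mult_left_mono) simp
      then show "(\<integral>\<^sup>+ t. ennreal (cmod (f t * complex_of_real (h t))) \<partial>\<mu>)
          \<le> inverse (semivariation \<nu> UNIV)"
        by (simp add: hm_int[OF f] inv_r mult.assoc[symmetric] cancel)
    qed
    \<comment> \<open>The constant of \<open>\<nu>\<close>-norm \<open>1\<close>, at which the supremum in the norm of \<open>h\<close> is attained.\<close>
    let ?c = "\<lambda>_::'g. complex_of_real (inverse r)"
    have c1: "vm_norm \<nu> ?c = 1"
      using r cancel by (simp only: vm_norm_const[OF \<nu>] S norm_of_real) simp
    have "vm_norm \<nu> (\<lambda>t. ?c t - ?c t) < ennreal \<epsilon>" if "\<epsilon> > 0" for \<epsilon>
      using that vm_norm_const[OF \<nu>, of 0] by simp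
    then have "?c \<in> L1_vm \<nu>"
      unfolding L1_vm_def L1_weak_def using c1
      by (auto intro!: exI[of _ ?c] simp: simple_function_const)
    then have "?c \<in> {f \<in> L1_vm \<nu>. vm_norm \<nu> f \<le> 1}" using c1 by simp
    then have "(\<integral>\<^sup>+ t. ennreal (cmod (?c t * complex_of_real (h t))) \<partial>\<mu>)
        \<le> kothe_norm \<nu> \<mu> (\<lambda>t. complex_of_real (h t))"
      unfolding kothe_norm_def by (rule SUP_upper)
    also have "(\<integral>\<^sup>+ t. ennreal (cmod (?c t * complex_of_real (h t))) \<partial>\<mu>) = ennreal (inverse r)"
      using r by (subst hm_int) (simp_all add: haar_space[OF m] haar_total[OF m] norm_inverse)
    finally show "inverse (semivariation \<nu> UNIV) \<le> kothe_norm \<nu> \<mu> (\<lambda>t. complex_of_real (h t))"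
      unfolding inv_r .
  qed
  moreover have "measure m A = (LINT t:A|\<mu>. h t)" if A: "A \<in> sets borel" for A
  proof -
    have "(LINT t:A|\<mu>. h t) = enn2real (\<integral>\<^sup>+ t. ennreal (indicator A t *\<^sub>R h t) \<partial>\<mu>)"
      unfolding set_lebesgue_integral_def using A hm h0
      by (intro integral_eq_nn_integral) (auto simp: meas\<mu>)
    also have "(\<integral>\<^sup>+ t. ennreal (indicator A t *\<^sub>R h t) \<partial>\<mu>) = emeasure m A"
      unfolding em[OF A] using hk
      by (intro nn_integral_cong_AE, eventually_elim) (simp add: indicator_def)
    finally show ?thesis by (simp add: measure_def)
  qed
  ultimately show ?thesis by blast
qed

end
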